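(* Let $(H_n)$ be a sequence of $k$-uniform hypergraphs, let $\alpha>0$, let $(\mathcal B_n)$ be a sequence of families with $\mathcal B_n\subseteq \mathcal P(V(H_n))$, and suppose that $(H_n)$ is $(\alpha,(\mathcal B_n))$-stable. Furthermore, let $K>0$ and let $(p_n)$ be a sequence of probabilities such that $p_n^k|H_n|\to\infty$ as $n\to\infty$, $(H_n)$ is $(K,(p_n))$-bounded, and $|\mathcal B_n|=\exp(o(p_n|V(H_n)|))$. Then for every $\delta>0$ there exist positive $\xi$, $b$, $C$, $N$ such that for every $n\geq N$ and every $q$ with $Cp_n\leq q\leq 1$, the following holds with probability at least $1-\exp(-bq|V(H_n)|)$: every subset $W\subseteq V(H_n)_q$ with $|W|\geq(\alpha-\xi)q|V(H_n)|$ that satisfies $|W\setminus B|\geq \delta q|V(H_n)|$ for every $B\in\mathcal B_n$ satisfies $|H_n[W]|\geq \xi q^k|H_n|>0$.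
   Context: For a finite set $X$ and $q\in[0,1]$, $X_q$ denotes the $q$-random subset of $X$ (each element included independently with probability $q$). For a hypergraph $H$, $|H|$ denotes its number of edges and $H[U]$ the subhypergraph induced on $U\subseteq V(H)$ (edges fully contained in $U$). $\mathcal P(S)$ is the power set of $S$. $(\alpha,(\mathcal B_n))$-stable: for every $\delta>0$ there exist $\varepsilon>0$ and $N$ such that for every $n\ge N$ and every $U\subseteq V(H_n)$ with $|U|\geq(\alpha-\varepsilon)|V(H_n)|$, either $|H_n[U]|\geq\varepsilon|H_n|$ or $|U\setminus B|\le\delta|V(H_n)|$ for some $B\in\mathcal B_n$. For a hypergraph $H$, $v\in V(H)$, $U\subseteq V(H)$ and integer $i$, let $\deg_i(v,U)=|\{e\in H: v\in e,\ |e\cap(U\setminus\{v\})|\ge i\}|$, and for $q\in[0,1]$ let $\mu_i(H,q)=\mathbb E\left[\sum_{v\in V(H)}\deg_i^2(v,V(H)_q)\right]$. $(K,(p_n))$-bounded: for every $i\in\{0,\dots,k-1\}$ there exists $N$ such that for every $n\ge N$ and every $q\in[0,1]$ with $q\ge p_n$, $\mu_i(H_n,q)\le Kq^{2i}|H_n|^2/|V(H_n)|$. *)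

theory Defs
  imports "HOL-Probability.Probability" "HOL-Library.Landau_Symbols"
begin

record 'a hypergraph =
  verts :: "'a set"
  edges :: "'a set set"

definition uniform_hypergraph :: "nat \<Rightarrow> 'a hypergraph \<Rightarrow> bool" where
  "uniform_hypergraph k H \<longleftrightarrow>
     finite (verts H) \<and> (\<forall>e\<in>edges H. e \<subseteq> verts H \<and> card e = k)"

definition induced :: "'a hypergraph \<Rightarrow> 'a set \<Rightarrow> 'a hypergraph" where
  "induced H U = \<lparr>verts = U, edges = {e \<in> edges H. e \<subseteq> U}\<rparr>"

text \<open>\<open>X\<^sub>q\<close> for a finite set \<open>X\<close>; only meaningful for \<open>0 \<le> q \<le> 1\<close>, since
  \<^const>\<open>bernoulli_pmf\<close> clamps its parameter to that interval.\<close>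

definition random_subset :: "'a set \<Rightarrow> real \<Rightarrow> 'a set pmf" where
  "random_subset X q =
     map_pmf (\<lambda>f. {x \<in> X. f x}) (Pi_pmf X False (\<lambda>_. bernoulli_pmf q))"

definition deg :: "nat \<Rightarrow> 'a hypergraph \<Rightarrow> 'a \<Rightarrow> 'a set \<Rightarrow> nat" where
  "deg i H v U = card {e \<in> edges H. v \<in> e \<and> card (e \<inter> (U - {v})) \<ge> i}"

definition mu :: "nat \<Rightarrow> 'a hypergraph \<Rightarrow> real \<Rightarrow> real" where
  "mu i H q = measure_pmf.expectation (random_subset (verts H) q)
     (\<lambda>R. \<Sum>v\<in>verts H. (real (deg i H v R))\<^sup>2)"

definition stable_seq :: "real \<Rightarrow> (nat \<Rightarrow> 'a set set) \<Rightarrow> (nat \<Rightarrow> 'a hypergraph) \<Rightarrow> bool" where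
  "stable_seq \<alpha> \<B> H \<longleftrightarrow>
     (\<forall>\<delta>>0. \<exists>\<epsilon>>0. \<exists>N. \<forall>n\<ge>N. \<forall>U\<subseteq>verts (H n).
        real (card U) \<ge> (\<alpha> - \<epsilon>) * real (card (verts (H n))) \<longrightarrow>
        real (card (edges (induced (H n) U))) \<ge> \<epsilon> * real (card (edges (H n))) \<or>
        (\<exists>B\<in>\<B> n. real (card (U - B)) \<le> \<delta> * real (card (verts (H n)))))"

definition bounded_seq ::
  "nat \<Rightarrow> real \<Rightarrow> (nat \<Rightarrow> real) \<Rightarrow> (nat \<Rightarrow> 'a hypergraph) \<Rightarrow> bool" where
  "bounded_seq k K p H \<longleftrightarrow>
     (\<forall>i<k. \<exists>N. \<forall>n\<ge>N. \<forall>q\<in>{0..1}. q \<ge> p n \<longrightarrow>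
        mu i (H n) q
          \<le> K * q ^ (2 * i) * (real (card (edges (H n))))\<^sup>2 / real (card (verts (H n))))"

end

theory Submission imports Defs begin

text \<open>The proof uses hypergraph containers rather than multi-round exposure. The second-moment bounds
  on degrees show that, after deleting a small proportion of the edges, the number of edges containing
  a set \<open>T\<close> is at most \<open>M p\<^bsup>|T|-1\<^esup> |H| / |V|\<close>. For such a hypergraph, every set \<open>W\<close> spanning only
  \<open>\<xi> p\<^sup>k |H|\<close> edges has a fingerprint, consisting of boundedly many subsets of \<open>W\<close> of size \<open>O(p |V|)\<close>,
  which determines a set \<open>A\<close> with fewer than \<open>\<epsilon> |H|\<close> edges containing all but \<open>O(p |V|)\<close> elements
  of \<open>W\<close>. By stability \<open>A\<close> is either small or close to one \<open>B\<close>, so an exceptional \<open>W\<close> contained in the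
  random set makes the latter unusually dense on \<open>A\<close> or on \<open>A - B\<close>. If \<open>p = \<eta> q\<close> with \<open>\<eta>\<close> small, the
  Chernoff bound for this event beats the number of fingerprints inside the random set.\<close>

subsection \<open>Weighted uniform hypergraphs\<close>

text \<open>A union bound over the exceptional sets \<open>W\<close> themselves is hopeless: a
  random set with about \<open>q |V|\<close> elements has about \<open>2 ^ (q |V|)\<close> subsets,
  while the available tails are only \<open>exp (- b * q * |V|)\<close> with small \<open>b\<close>.
  The union \<open>S\<close> of a fingerprint has size at most a small multiple of
  \<open>q |V|\<close> and lies in the random set with probability \<open>q ^ |S|\<close>. This
  factor cancels the cost of locating \<open>S\<close> among all vertices, and what remains is
  \<open>exp (c * q * |V|)\<close> with \<open>c\<close> as small as desired. Containment of
  \<open>S\<close> and the density on the container are therefore estimated jointly. Edges carry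
  weights because one set can lie in the links of several fingerprint vertices, and this
  multiplicity has to survive the induction on the uniformity. The obstacle in that induction is
  that a growing sum of links may concentrate on a few sets \<open>T\<close>. Hence the edges above
  \<open>T\<close> are no longer added once the degree of \<open>T\<close> has passed a cap.\<close>

definition wt :: "('a set \<Rightarrow> real) \<Rightarrow> 'a set \<Rightarrow> 'a set \<Rightarrow> real" where
  "wt G T W = (\<Sum>e | T \<subseteq> e \<and> e \<subseteq> W. G e)"

definition uniform_weights :: "nat \<Rightarrow> 'a set \<Rightarrow> ('a set \<Rightarrow> real) \<Rightarrow> bool" where
  "uniform_weights k V G \<longleftrightarrow>
     finite V \<and> (\<forall>e. 0 \<le> G e) \<and> (\<forall>e. G e \<noteq> 0 \<longrightarrow> e \<subseteq> V \<and> card e = k)"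

text \<open>\<open>D\<close> plays the role of the average degree \<open>|H| / |V|\<close>. Passing
  to the link of a vertex puts one more element into \<open>T\<close>, so the same \<open>M\<close>
  stays valid there with \<open>p * D\<close> in place of \<open>D\<close>.\<close>

definition degrees_le :: "real \<Rightarrow> 'a set \<Rightarrow> real \<Rightarrow> real \<Rightarrow> ('a set \<Rightarrow> real) \<Rightarrow> bool" where
  "degrees_le M V p D G \<longleftrightarrow>
     (\<forall>T. T \<noteq> {} \<longrightarrow> T \<subseteq> V \<longrightarrow> wt G T V \<le> M * D * p ^ (card T - 1))"

text \<open>\<open>F\<close> precedes \<open>W\<close>, so the removed set is a function of the
  fingerprint alone and can be counted. \<open>N\<close> is a scale separate from
  \<open>card V\<close>: iteration shrinks the vertex set while the scale remains that of the
  original one.\<close>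

definition removes ::
  "nat \<Rightarrow> real \<Rightarrow> real \<Rightarrow> 'a set \<Rightarrow> real \<Rightarrow> real \<Rightarrow> real \<Rightarrow> ('a set \<Rightarrow> real) \<Rightarrow> bool" where
  "removes k c \<xi> V N p D G \<longleftrightarrow>
     (\<exists>F. \<forall>W\<subseteq>V. wt G {} W \<le> \<xi> * p ^ k * D * N \<longrightarrow>
        (\<exists>Ss. length Ss = k \<and> (\<forall>S\<in>set Ss. S \<subseteq> W \<and> real (card S) \<le> 2 * p * N) \<and>
           F Ss \<subseteq> V \<and> c * N \<le> real (card (F Ss)) \<and> real (card (W \<inter> F Ss)) \<le> 2 * p * N))"

lemma finite_wt_index: "finite W \<Longrightarrow> finite {e. T \<subseteq> e \<and> e \<subseteq> W}"
  by (rule finite_subset[of _ "Pow W"]) auto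

lemma wt_nonneg: "(\<And>e. 0 \<le> G e) \<Longrightarrow> 0 \<le> wt G T W"
  unfolding wt_def by (simp add: sum_nonneg)

lemma wt_mono:
  assumes "finite W'" "W \<subseteq> W'" "T' \<subseteq> T" "\<And>e. 0 \<le> G' e" "\<And>e. G e \<le> G' e"
  shows "wt G T W \<le> wt G' T' W'"
proof -
  have "wt G T W \<le> wt G' T W" unfolding wt_def by (rule sum_mono) (use assms in auto)
  also have "\<dots> \<le> wt G' T' W'" unfolding wt_def
    by (rule sum_mono2) (use assms finite_wt_index in auto)
  finally show ?thesis .
qed

lemma wt_add: "wt (\<lambda>e. G e + G' e) T W = wt G T W + wt G' T W"
  by (simp add: wt_def sum.distrib)

lemma wt_empty: "wt G {} W = (\<Sum>e\<in>Pow W. G e)"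
  by (simp add: wt_def Pow_def)

lemma sum_insert_eq:
  assumes "v \<in> W" "v \<notin> T"
  shows "(\<Sum>e | T \<subseteq> e \<and> e \<subseteq> W \<and> v \<notin> e. h (insert v e)) = (\<Sum>f | T \<subseteq> f \<and> f \<subseteq> W \<and> v \<in> f. h f)"
  by (rule sum.reindex_bij_witness[where i="\<lambda>f. f - {v}" and j="insert v"])
     (use assms in \<open>auto simp: insert_absorb\<close>)

lemma wt_link_le:
  assumes "finite W" "v \<in> W" "\<And>e. 0 \<le> G e"
    and "\<And>e. 0 \<le> L e" "\<And>e. L e \<le> (if v \<in> e then 0 else G (insert v e))"
  shows "wt L T W \<le> wt G (insert v T) W"
proof (cases "v \<in> T")
  case True
  have "L e = 0" if "v \<in> e" for e using assms(4,5)[of e] that by simp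
  then have "wt L T W = 0" unfolding wt_def using True by (intro sum.neutral) auto
  then show ?thesis using wt_nonneg[of G] assms by simp
next
  case False
  have "wt L T W \<le> (\<Sum>e | T \<subseteq> e \<and> e \<subseteq> W. if v \<in> e then 0 else G (insert v e))"
    unfolding wt_def by (rule sum_mono) (use assms in auto)
  also have "\<dots> = (\<Sum>e | T \<subseteq> e \<and> e \<subseteq> W \<and> v \<notin> e. G (insert v e))"
    by (rule sum.mono_neutral_cong_right) (use assms finite_wt_index in auto)
  also have "\<dots> = (\<Sum>f | T \<subseteq> f \<and> f \<subseteq> W \<and> v \<in> f. G f)"
    by (rule sum_insert_eq) (use assms False in auto)
  also have "\<dots> = wt G (insert v T) W"
    unfolding wt_def by (rule sum.cong) (use False in auto)
  finally show ?thesis .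
qed

text \<open>Double counting: \<open>f\<close> arises once from each of its elements
  \<open>v\<close>, as \<open>insert v (f - {v})\<close>.\<close>

lemma sum_insert_reindex:
  assumes "finite W"
  shows "(\<Sum>v\<in>W. \<Sum>e | e \<subseteq> W \<and> v \<notin> e. h (insert v e)) = (\<Sum>f\<in>Pow W. real (card f) * h f)"
proof -
  have "(\<Sum>e | e \<subseteq> W \<and> v \<notin> e. h (insert v e)) = (\<Sum>f\<in>Pow W. if v \<in> f then h f else 0)"
    if "v \<in> W" for v
  proof -
    have "(\<Sum>e | e \<subseteq> W \<and> v \<notin> e. h (insert v e)) = (\<Sum>f | f \<subseteq> W \<and> v \<in> f. h f)"
      using sum_insert_eq[OF that, of "{}" h] by simp
    also have "\<dots> = (\<Sum>f\<in>Pow W. if v \<in> f then h f else 0)"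
      by (rule sum.mono_neutral_cong_left) (use assms in auto)
    finally show ?thesis .
  qed
  then have "(\<Sum>v\<in>W. \<Sum>e | e \<subseteq> W \<and> v \<notin> e. h (insert v e)) =
      (\<Sum>v\<in>W. \<Sum>f\<in>Pow W. if v \<in> f then h f else 0)" by (rule sum.cong[OF refl])
  also have "\<dots> = (\<Sum>f\<in>Pow W. \<Sum>v\<in>W. if v \<in> f then h f else 0)" by (rule sum.swap)
  also have "\<dots> = (\<Sum>f\<in>Pow W. real (card f) * h f)"
  proof (rule sum.cong[OF refl])
    fix f assume "f \<in> Pow W"
    then have "W \<inter> {v. v \<in> f} = f" by auto
    then show "(\<Sum>v\<in>W. if v \<in> f then h f else 0) = real (card f) * h f"
      using assms by (simp add: sum.If_cases)
  qed
  finally show ?thesis .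
qed

text \<open>An edge carrying weight has \<open>k\<close> elements, so it is counted for exactly
  \<open>2 ^ k\<close> sets \<open>T\<close>, the empty one included.\<close>

lemma sum_wt_le:
  assumes "uniform_weights k V L"
  shows "(\<Sum>T\<in>Pow V. wt L T V) = 2 ^ k * wt L {} V"
proof -
  have fin: "finite V" using assms by (simp add: uniform_weights_def)
  have "(\<Sum>T\<in>Pow V. wt L T V) = (\<Sum>T\<in>Pow V. \<Sum>e\<in>Pow V. if T \<subseteq> e then L e else 0)"
    unfolding wt_def by (rule sum.cong[OF refl], rule sum.mono_neutral_cong_left) (use fin in auto)
  also have "\<dots> = (\<Sum>e\<in>Pow V. \<Sum>T\<in>Pow V. if T \<subseteq> e then L e else 0)" by (rule sum.swap)
  also have "\<dots> = (\<Sum>e\<in>Pow V. 2 ^ k * L e)"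
  proof (rule sum.cong[OF refl])
    fix e assume e: "e \<in> Pow V"
    then have "Pow V \<inter> {T. T \<subseteq> e} = Pow e" by auto
    then have "(\<Sum>T\<in>Pow V. if T \<subseteq> e then L e else 0) = 2 ^ card e * L e"
      using fin e by (simp add: sum.If_cases card_Pow finite_subset)
    then show "(\<Sum>T\<in>Pow V. if T \<subseteq> e then L e else 0) = 2 ^ k * L e"
      using assms by (cases "L e = 0") (auto simp: uniform_weights_def)
  qed
  finally show ?thesis by (simp add: wt_empty sum_distrib_left)
qed

subsection \<open>Containers for sparse sets\<close>

text \<open>In uniformity 0 all weight sits on the empty edge, so every \<open>W\<close> inherits
  the whole weight of \<open>V\<close> and exceeds the threshold. The condition on \<open>W\<close>
  never holds, and \<open>c\<close> can be arbitrary.\<close>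

lemma removes_0:
  assumes "uniform_weights 0 V G" "\<beta> * D * N \<le> wt G {} V" "\<beta> > 0" "D > 0" "N > 0"
  shows "removes 0 c (\<beta> / 2) V N p D G"
proof -
  have fin: "finite V" using assms(1) by (simp add: uniform_weights_def)
  have wt: "wt G {} W = G {}" if "W \<subseteq> V" for W
  proof -
    have "(\<Sum>e\<in>Pow W. G e) = (\<Sum>e\<in>{{}}. G e)"
    proof (rule sum.mono_neutral_right)
      show "finite (Pow W)" using fin that finite_subset by auto
      have "e = {}" if "e \<subseteq> V" "card e = 0" for e using that fin finite_subset by fastforce
      then show "\<forall>e\<in>Pow W - {{}}. G e = 0" using assms(1) unfolding uniform_weights_def by blast
    qed auto
    then show ?thesis by (simp add: wt_empty)
  qed
  have "0 < \<beta> * D * N" using assms by simp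
  then have "\<not> wt G {} W \<le> \<beta> / 2 * p ^ 0 * D * N" if "W \<subseteq> V" for W
    using assms(2) wt[OF that] wt[of V] by simp
  then show ?thesis unfolding removes_def by blast
qed

text \<open>\<open>L\<close> collects parts of the links of the vertices of \<open>S\<close>. A fingerprint set \<open>S\<close> that is chosen
  maximal either carries an \<open>L\<close> heavy enough for induction on the uniformity, or no further vertex
  has a large link that avoids the saturated sets.\<close>

definition fingerprint_link ::
  "nat \<Rightarrow> real \<Rightarrow> real \<Rightarrow> 'a set \<Rightarrow> real \<Rightarrow> real \<Rightarrow> ('a set \<Rightarrow> real) \<Rightarrow> 'a set \<Rightarrow> ('a set \<Rightarrow> real) \<Rightarrow> bool" where
  "fingerprint_link k \<beta> M V p D G S L \<longleftrightarrow>
     uniform_weights k V L \<and> degrees_le M V p (p * D) L \<and>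
     (\<forall>e. L e \<le> (\<Sum>v\<in>S - e. G (insert v e))) \<and> real (card S) * \<beta> * D \<le> wt L {} V"

definition saturated :: "real \<Rightarrow> 'a set \<Rightarrow> real \<Rightarrow> real \<Rightarrow> ('a set \<Rightarrow> real) \<Rightarrow> 'a set set" where
  "saturated M V p D L = {T. T \<noteq> {} \<and> T \<subseteq> V \<and> M * D * p ^ (card T - 1) < wt L T V}"

text \<open>A set in \<open>\<T>\<close> gains no degree when this function is added to
  \<open>L\<close>. This is what enforces a degree cap while the fingerprint set grows.\<close>

definition open_link :: "('a set \<Rightarrow> real) \<Rightarrow> 'a set set \<Rightarrow> 'a \<Rightarrow> 'a set \<Rightarrow> real" where
  "open_link G \<T> v e = (if v \<in> e \<or> (\<exists>T\<in>\<T>. T \<subseteq> e) then 0 else G (insert v e))"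

lemma fingerprint_link_empty:
  assumes "finite V" "M \<ge> 0" "p \<ge> 0" "D \<ge> 0"
  shows "fingerprint_link k \<beta> M V p D G {} (\<lambda>_. 0)"
  using assms by (auto simp: fingerprint_link_def uniform_weights_def degrees_le_def wt_def)

lemma uniform_weights_finite: "uniform_weights k V G \<Longrightarrow> finite V"
  and uniform_weights_nonneg: "uniform_weights k V G \<Longrightarrow> 0 \<le> G e"
  by (auto simp: uniform_weights_def)

lemma power_card_insert:
  assumes "finite T" "T \<noteq> {}"
  shows "(p::real) ^ card T = p * p ^ (card T - 1)"
  using assms by (metis card_gt_0_iff power_eq_if not_gr_zero)

text \<open>The cap is overshot by at most one step. A saturated \<open>T\<close> gains nothing; any
  other \<open>T\<close> is still below the \<open>M1\<close> bound and gains at most the degree of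
  \<open>insert w T\<close> in \<open>G\<close>, which the \<open>M\<close> bound controls. So
  \<open>M + M1\<close> is preserved by any number of insertions.\<close>

lemma fingerprint_link_insert:
  assumes G: "uniform_weights (Suc k) V G" "degrees_le M V p D G"
    and L: "fingerprint_link k \<beta> (M + M1) V p D G S L"
    and w: "w \<in> V" "w \<notin> S" "S \<subseteq> V"
    and pos: "M \<ge> 0" "p \<ge> 0" "D \<ge> 0"
    and \<T>: "\<T> = saturated M1 V p (p * D) L"
    and rich: "\<beta> * D \<le> wt (open_link G \<T> w) {} V"
  shows "fingerprint_link k \<beta> (M + M1) V p D G (insert w S) (\<lambda>e. L e + open_link G \<T> w e)"
proof -
  note fin = uniform_weights_finite[OF G(1)] and nn = uniform_weights_nonneg[OF G(1)]
  have L': "uniform_weights k V L" "degrees_le (M + M1) V p (p * D) L"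
    "\<And>e. L e \<le> (\<Sum>v\<in>S - e. G (insert v e))" "real (card S) * \<beta> * D \<le> wt L {} V"
    using L by (auto simp: fingerprint_link_def)
  have finS: "finite S" using fin w(3) finite_subset by auto
  have ol: "0 \<le> open_link G \<T> w e" "open_link G \<T> w e \<le> (if w \<in> e then 0 else G (insert w e))" for e
    using nn by (auto simp: open_link_def)
  have ol_supp: "e \<subseteq> V \<and> card e = k" if "open_link G \<T> w e \<noteq> 0" for e
  proof -
    have "w \<notin> e" "G (insert w e) \<noteq> 0" using that by (auto simp: open_link_def split: if_splits)
    then have "insert w e \<subseteq> V" "card (insert w e) = Suc k" using G(1) by (auto simp: uniform_weights_def)
    moreover then have "finite e" using fin finite_subset by auto
    ultimately show ?thesis using \<open>w \<notin> e\<close> by auto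
  qed
  have "uniform_weights k V (\<lambda>e. L e + open_link G \<T> w e)"
    using L'(1) ol(1) ol_supp unfolding uniform_weights_def by (metis add_0 add_nonneg_nonneg)
  moreover have "degrees_le (M + M1) V p (p * D) (\<lambda>e. L e + open_link G \<T> w e)"
    unfolding degrees_le_def wt_add
  proof (intro allI impI)
    fix T assume T: "T \<noteq> {}" "T \<subseteq> V"
    show "wt L T V + wt (open_link G \<T> w) T V \<le> (M + M1) * (p * D) * p ^ (card T - 1)"
    proof (cases "T \<in> \<T>")
      case True
      then have "wt (open_link G \<T> w) T V = 0"
        unfolding wt_def by (intro sum.neutral) (auto simp: open_link_def)
      then show ?thesis using L'(2) T by (simp add: degrees_le_def)
    next
      case False
      have finT: "finite T" using T fin finite_subset by auto
      have "wt (open_link G \<T> w) T V \<le> M * D * p ^ card T"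
      proof (cases "w \<in> T")
        case True
        then have "wt (open_link G \<T> w) T V = 0"
          unfolding wt_def by (intro sum.neutral) (auto simp: open_link_def)
        then show ?thesis using pos by simp
      next
        case False
        have "wt (open_link G \<T> w) T V \<le> wt G (insert w T) V"
          by (rule wt_link_le) (use fin w nn ol in auto)
        also have "\<dots> \<le> M * D * p ^ (card (insert w T) - 1)"
          using G(2) w T by (simp add: degrees_le_def)
        finally show ?thesis using False finT by simp
      qed
      moreover have "wt L T V \<le> M1 * (p * D) * p ^ (card T - 1)"
        using False T by (auto simp: \<T> saturated_def)
      ultimately show ?thesis
        using power_card_insert[OF finT T(1), of p] by (simp add: algebra_simps)
    qed
  qed
  moreover have "L e + open_link G \<T> w e \<le> (\<Sum>v\<in>insert w S - e. G (insert v e))" for e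
  proof (cases "w \<in> e")
    case True
    then show ?thesis using L'(3)[of e] ol(1,2)[of e] by (simp add: insert_Diff_if)
  next
    case False
    then show ?thesis using L'(3)[of e] ol(2)[of e] w(2) finS by (simp add: insert_Diff_if)
  qed
  moreover have "real (card (insert w S)) * \<beta> * D \<le> wt (\<lambda>e. L e + open_link G \<T> w e) {} V"
    unfolding wt_add using L'(4) rich w(2) finS by (simp add: algebra_simps)
  ultimately show ?thesis by (auto simp: fingerprint_link_def)
qed

text \<open>Each vertex of \<open>S\<close> contributes at most its degree in
  \<open>G\<close>.\<close>

lemma wt_fingerprint_link_le:
  assumes G: "uniform_weights (Suc k) V G" "degrees_le M V p D G"
    and L: "fingerprint_link k \<beta> M' V p D G S L" and S: "S \<subseteq> V"
  shows "wt L {} V \<le> real (card S) * M * D"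
proof -
  note fin = uniform_weights_finite[OF G(1)] and nn = uniform_weights_nonneg[OF G(1)]
  have finS: "finite S" using fin S finite_subset by auto
  have "wt L {} V \<le> (\<Sum>e\<in>Pow V. \<Sum>v\<in>S - e. G (insert v e))"
    unfolding wt_empty using L by (intro sum_mono) (auto simp: fingerprint_link_def)
  also have "\<dots> = (\<Sum>e\<in>Pow V. \<Sum>v\<in>S. if v \<in> e then 0 else G (insert v e))"
    by (rule sum.cong[OF refl], rule sum.mono_neutral_cong_left) (use finS in auto)
  also have "\<dots> = (\<Sum>v\<in>S. wt (\<lambda>e. if v \<in> e then 0 else G (insert v e)) {} V)"
    unfolding wt_empty by (rule sum.swap)
  also have "\<dots> \<le> (\<Sum>v\<in>S. wt G {v} V)"
    by (intro sum_mono wt_link_le) (use fin S nn in auto)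
  also have "\<dots> \<le> (\<Sum>v\<in>S. M * D)"
    by (rule sum_mono) (use G(2) S in \<open>force simp: degrees_le_def\<close>)
  finally show ?thesis by (simp add: mult_ac)
qed

text \<open>Adding a vertex of \<open>S \<subseteq> W\<close> to an edge of \<open>L\<close> inside
  \<open>W\<close> gives an edge of \<open>G\<close> inside \<open>W\<close>, and each of those
  arises at most \<open>Suc k\<close> times. In this way the sparsity of \<open>W\<close> passes to
  the link.\<close>

lemma wt_fingerprint_link_induced_le:
  assumes G: "uniform_weights (Suc k) V G"
    and L: "fingerprint_link k \<beta> M V p D G S L" and W: "S \<subseteq> W" "W \<subseteq> V"
  shows "wt L {} W \<le> real (Suc k) * wt G {} W"
proof -
  note fin = uniform_weights_finite[OF G] and nn = uniform_weights_nonneg[OF G]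
  have finW: "finite W" using fin W finite_subset by auto
  have "wt L {} W \<le> (\<Sum>e\<in>Pow W. \<Sum>v\<in>S - e. G (insert v e))"
    unfolding wt_empty using L by (intro sum_mono) (auto simp: fingerprint_link_def)
  also have "\<dots> \<le> (\<Sum>e\<in>Pow W. \<Sum>v\<in>W. if v \<in> e then 0 else G (insert v e))"
  proof (rule sum_mono)
    fix e
    have "(\<Sum>v\<in>S - e. G (insert v e)) \<le> (\<Sum>v\<in>W - e. G (insert v e))"
      by (rule sum_mono2) (use finW W nn in auto)
    also have "\<dots> = (\<Sum>v\<in>W. if v \<in> e then 0 else G (insert v e))"
      by (rule sum.mono_neutral_cong_left) (use finW in auto)
    finally show "(\<Sum>v\<in>S - e. G (insert v e)) \<le> (\<Sum>v\<in>W. if v \<in> e then 0 else G (insert v e))" .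
  qed
  also have "\<dots> = (\<Sum>v\<in>W. \<Sum>e\<in>Pow W. if v \<in> e then 0 else G (insert v e))" by (rule sum.swap)
  also have "\<dots> = (\<Sum>v\<in>W. \<Sum>e | e \<subseteq> W \<and> v \<notin> e. G (insert v e))"
    by (rule sum.cong[OF refl], rule sum.mono_neutral_cong_right) (use finW in auto)
  also have "\<dots> = (\<Sum>f\<in>Pow W. real (card f) * G f)" by (rule sum_insert_reindex[OF finW])
  also have "\<dots> = (\<Sum>f\<in>Pow W. real (Suc k) * G f)"
  proof (rule sum.cong[OF refl])
    fix f show "real (card f) * G f = real (Suc k) * G f"
      using G by (cases "G f = 0") (auto simp: uniform_weights_def)
  qed
  finally show ?thesis by (simp add: wt_empty sum_distrib_left)
qed

text \<open>On saturated sets the degree in \<open>G\<close> is at most \<open>M / (M1 * p)\<close>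
  times the degree in \<open>L\<close>. The degrees in \<open>L\<close> sum to \<open>2 ^ k\<close>
  times its weight, which is at most \<open>p * N * M * D\<close>; \<open>M1\<close> is the value
  that turns the product into \<open>\<beta> / 4 * D * N\<close>.\<close>

lemma sum_saturated_le:
  assumes G: "uniform_weights (Suc k) V G" "degrees_le M V p D G"
    and L: "fingerprint_link k \<beta>' M' V p D G S L" and S: "S \<subseteq> V" "real (card S) \<le> p * N"
    and pos: "\<beta> > 0" "M > 0" "p > 0" "D > 0" "N > 0"
    and M1: "M1 = 2 ^ (k + 2) * M\<^sup>2 / \<beta>"
  shows "(\<Sum>T\<in>saturated M1 V p (p * D) L. wt G T V) \<le> \<beta> / 4 * D * N"
proof -
  note fin = uniform_weights_finite[OF G(1)]
  have L': "uniform_weights k V L" using L by (simp add: fingerprint_link_def)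
  have M1_pos: "M1 > 0" using pos by (simp add: M1)
  let ?\<T> = "saturated M1 V p (p * D) L"
  have sub: "?\<T> \<subseteq> Pow V" by (auto simp: saturated_def)
  have "(\<Sum>T\<in>?\<T>. wt G T V) \<le> (\<Sum>T\<in>?\<T>. M / (M1 * p) * wt L T V)"
  proof (rule sum_mono)
    fix T assume T: "T \<in> ?\<T>"
    then have "wt G T V \<le> M * D * p ^ (card T - 1)" using G(2) by (simp add: degrees_le_def saturated_def)
    also have "\<dots> = M / (M1 * p) * (M1 * (p * D) * p ^ (card T - 1))" using pos M1_pos by simp
    also have "\<dots> \<le> M / (M1 * p) * wt L T V"
      using T pos M1_pos by (intro mult_left_mono) (auto simp: saturated_def)
    finally show "wt G T V \<le> M / (M1 * p) * wt L T V" .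
  qed
  also have "\<dots> \<le> (\<Sum>T\<in>Pow V. M / (M1 * p) * wt L T V)"
    using sub fin pos M1_pos uniform_weights_nonneg[OF L']
    by (intro sum_mono2) (auto intro!: mult_nonneg_nonneg divide_nonneg_nonneg wt_nonneg)
  also have "\<dots> = M / (M1 * p) * (2 ^ k * wt L {} V)"
    by (simp only: sum_distrib_left[symmetric] sum_wt_le[OF L'])
  also have "\<dots> \<le> M / (M1 * p) * (2 ^ k * (p * N * M * D))"
  proof (intro mult_left_mono)
    have "wt L {} V \<le> real (card S) * M * D" by (rule wt_fingerprint_link_le[OF G L S(1)])
    also have "\<dots> \<le> p * N * M * D" using S(2) pos by (intro mult_right_mono) auto
    finally show "wt L {} V \<le> p * N * M * D" .
  qed (use pos M1_pos in auto)
  also have "\<dots> = \<beta> / 4 * D * N"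
    using pos by (simp add: M1 field_simps power2_eq_square)
  finally show ?thesis .
qed

text \<open>Three quarters of \<open>\<beta> * D * N\<close> survive the removal of the edges above
  \<open>\<T>\<close>. Vertices with a small open link account for at most two of these quarters, so
  one is left for the others, each carrying at most \<open>M * D\<close>.\<close>

lemma card_rich_ge:
  assumes G: "uniform_weights (Suc k) V G" "degrees_le M V p D G"
    and N: "real (card V) \<le> N"
    and wt: "\<beta> * D * N \<le> wt G {} V"
    and \<T>: "{} \<notin> \<T>" "\<T> \<subseteq> Pow V" "(\<Sum>T\<in>\<T>. wt G T V) \<le> \<beta> / 4 * D * N"
    and pos: "\<beta> > 0" "M > 0" "D > 0"
  shows "\<beta> / (4 * M) * N \<le> real (card {v \<in> V. \<beta> / 2 * D \<le> wt (open_link G \<T> v) {} V})"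
proof -
  note fin = uniform_weights_finite[OF G(1)] and nn = uniform_weights_nonneg[OF G(1)]
  define R where "R = {v \<in> V. \<beta> / 2 * D \<le> wt (open_link G \<T> v) {} V}"
  have R: "R \<subseteq> V" by (auto simp: R_def)
  define h where "h f = (if \<exists>T\<in>\<T>. T \<subseteq> f then 0 else G f)" for f
  have fin\<T>: "finite \<T>" using \<T>(2) fin finite_subset by blast
  have lower: "wt G {} V \<le> (\<Sum>f\<in>Pow V. h f) + (\<Sum>T\<in>\<T>. wt G T V)"
  proof -
    have "(\<Sum>T\<in>\<T>. wt G T V) = (\<Sum>T\<in>\<T>. \<Sum>f\<in>Pow V. if T \<subseteq> f then G f else 0)"
      unfolding wt_def by (rule sum.cong[OF refl], rule sum.mono_neutral_cong_left) (use fin in auto)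
    also have "\<dots> = (\<Sum>f\<in>Pow V. \<Sum>T\<in>\<T>. if T \<subseteq> f then G f else 0)" by (rule sum.swap)
    finally have *: "(\<Sum>T\<in>\<T>. wt G T V) = (\<Sum>f\<in>Pow V. \<Sum>T\<in>\<T>. if T \<subseteq> f then G f else 0)" .
    have "G f \<le> h f + (\<Sum>T\<in>\<T>. if T \<subseteq> f then G f else 0)" for f
    proof (cases "\<exists>T\<in>\<T>. T \<subseteq> f")
      case True
      then obtain T where T: "T \<in> \<T>" "T \<subseteq> f" by auto
      have "(if T \<subseteq> f then G f else 0) \<le> (\<Sum>T\<in>\<T>. if T \<subseteq> f then G f else 0)"
        by (rule member_le_sum) (use T fin\<T> nn in auto)
      then show ?thesis using T True by (simp add: h_def)
    next
      case False
      have "0 \<le> (\<Sum>T\<in>\<T>. if T \<subseteq> f then G f else 0)" using nn by (simp add: sum_nonneg)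
      then show ?thesis using False by (simp add: h_def)
    qed
    then show ?thesis unfolding * wt_empty by (simp add: sum_mono flip: sum.distrib)
  qed
  \<comment> \<open>The uniformity is \<open>Suc k\<close>, so every edge with weight has at least
    one vertex from which it is seen.\<close>
  have "(\<Sum>f\<in>Pow V. h f) \<le> (\<Sum>f\<in>Pow V. real (card f) * h f)"
  proof (rule sum_mono)
    fix f show "h f \<le> real (card f) * h f"
      using G(1) nn[of f] by (cases "G f = 0") (auto simp: h_def uniform_weights_def algebra_simps)
  qed
  also have "\<dots> = (\<Sum>v\<in>V. \<Sum>e | e \<subseteq> V \<and> v \<notin> e. h (insert v e))"
    by (rule sum_insert_reindex[OF fin, symmetric])
  also have "\<dots> \<le> (\<Sum>v\<in>V. wt (open_link G \<T> v) {} V)"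
  proof (rule sum_mono)
    fix v
    \<comment> \<open>A set of \<open>\<T>\<close> inside \<open>e\<close> is also inside
      \<open>insert v e\<close>, so \<open>h\<close> vanishes at \<open>insert v e\<close> wherever
      the open link vanishes because of \<open>\<T>\<close>.\<close>
    have "(\<Sum>e | e \<subseteq> V \<and> v \<notin> e. h (insert v e)) \<le> (\<Sum>e | e \<subseteq> V \<and> v \<notin> e. open_link G \<T> v e)"
      by (rule sum_mono) (use nn in \<open>auto simp: h_def open_link_def subset_insertI2\<close>)
    also have "\<dots> \<le> wt (open_link G \<T> v) {} V"
      unfolding wt_empty by (rule sum_mono2) (use fin nn in \<open>auto simp: open_link_def\<close>)
    finally show "(\<Sum>e | e \<subseteq> V \<and> v \<notin> e. h (insert v e)) \<le> wt (open_link G \<T> v) {} V" .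
  qed
  also have "\<dots> \<le> (\<Sum>v\<in>V. (if v \<in> R then M * D else 0) + \<beta> / 2 * D)"
  proof (rule sum_mono)
    fix v assume v: "v \<in> V"
    have "wt (open_link G \<T> v) {} V \<le> wt G {v} V"
      by (rule wt_link_le) (use v fin nn in \<open>auto simp: open_link_def\<close>)
    also have "\<dots> \<le> M * D" using G(2) v by (force simp: degrees_le_def)
    finally show "wt (open_link G \<T> v) {} V \<le> (if v \<in> R then M * D else 0) + \<beta> / 2 * D"
      using v pos by (auto simp: R_def intro: add_increasing2)
  qed
  also have "\<dots> = real (card R) * (M * D) + real (card V) * (\<beta> / 2 * D)"
    using fin by (simp add: sum.distrib sum.If_cases Int_absorb1[OF R])
  also have "\<dots> \<le> real (card R) * (M * D) + N * (\<beta> / 2 * D)"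
    using N pos by (intro add_left_mono mult_right_mono) auto
  finally have "\<beta> * D * N \<le> real (card R) * (M * D) + N * (\<beta> / 2 * D) + \<beta> / 4 * D * N"
    using lower wt \<T>(3) by linarith
  then have "D * (\<beta> / 4 * N) \<le> D * (real (card R) * M)" by (simp add: algebra_simps)
  then have "\<beta> / 4 * N \<le> real (card R) * M" using pos by (simp only: mult_le_cancel_left_pos)
  then show ?thesis unfolding R_def[symmetric] using pos by (simp add: field_simps)
qed

text \<open>The cap \<open>M1\<close> is chosen so that edges through saturated sets carry at most a quarter of the total
  weight. Since \<open>link\<close> depends on \<open>S\<close> alone, so does the removed set, although \<open>S\<close> is found inside
  the unknown \<open>W\<close>.\<close>

lemma removes_Suc:
  assumes G: "uniform_weights (Suc k) V G" "degrees_le M V p D G"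
    and N: "real (card V) \<le> N" "1 \<le> p * N" and wt: "\<beta> * D * N \<le> wt G {} V"
    and pos: "\<beta> > 0" "M > 0" "p > 0" "D > 0" "N > 0"
    and M1: "M1 = 2 ^ (k + 2) * M\<^sup>2 / \<beta>"
    and IH: "\<And>L. uniform_weights k V L \<Longrightarrow> degrees_le (M + M1) V p (p * D) L \<Longrightarrow>
      \<beta> / 2 * (p * D) * N \<le> wt L {} V \<Longrightarrow> removes k c' \<xi>' V N p (p * D) L"
    and c: "c \<le> c'" "c \<le> \<beta> / (4 * M)" and \<xi>: "real (Suc k) * \<xi> \<le> \<xi>'"
  shows "removes (Suc k) c \<xi> V N p D G"
proof -
  note fin = uniform_weights_finite[OF G(1)] and nn = uniform_weights_nonneg[OF G(1)]
  let ?good = "fingerprint_link k (\<beta> / 2) (M + M1) V p D G"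
  define link where "link S = (SOME L. ?good S L)" for S
  define FL where "FL L = (SOME F. \<forall>W\<subseteq>V. wt L {} W \<le> \<xi>' * p ^ k * (p * D) * N \<longrightarrow>
        (\<exists>Ss. length Ss = k \<and> (\<forall>S\<in>set Ss. S \<subseteq> W \<and> real (card S) \<le> 2 * p * N) \<and>
           F Ss \<subseteq> V \<and> c' * N \<le> real (card (F Ss)) \<and> real (card (W \<inter> F Ss)) \<le> 2 * p * N))" for L
  have FL: "\<exists>Ss. length Ss = k \<and> (\<forall>S\<in>set Ss. S \<subseteq> W \<and> real (card S) \<le> 2 * p * N) \<and>
           FL L Ss \<subseteq> V \<and> c' * N \<le> real (card (FL L Ss)) \<and> real (card (W \<inter> FL L Ss)) \<le> 2 * p * N"
    if "removes k c' \<xi>' V N p (p * D) L" "W \<subseteq> V" "wt L {} W \<le> \<xi>' * p ^ k * (p * D) * N" for L W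
    using someI_ex[OF that(1)[unfolded removes_def]] that(2,3) unfolding FL_def by blast
  define sat where "sat L = saturated M1 V p (p * D) L" for L
  define rich where "rich L = {v \<in> V. \<beta> / 2 * D \<le> wt (open_link G (sat L) v) {} V}" for L
  \<comment> \<open>The size of the first set reveals which of the two cases produced the list, so
    it can be decoded without \<open>W\<close>.\<close>
  define F where "F Ss = (if p * N \<le> real (card (hd Ss)) then FL (link (hd Ss)) (tl Ss)
    else rich (link (hd Ss)))" for Ss
  have M1_pos: "M1 > 0" using pos by (simp add: M1)
  show ?thesis unfolding removes_def
  proof (rule exI[of _ F], intro allI impI)
    fix W assume W: "W \<subseteq> V" and wtW: "wt G {} W \<le> \<xi> * p ^ Suc k * D * N"
    have finW: "finite W" using fin W finite_subset by auto
    \<comment> \<open>Rounding up costs at most a factor 2 because \<open>1 \<le> p * N\<close>;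
      this is the 2 in the bound \<open>2 * p * N\<close>.\<close>
    define m where "m = nat \<lceil>p * N\<rceil>"
    have m: "p * N \<le> real m" "real m \<le> 2 * p * N" using N(2) unfolding m_def by linarith+
    define \<S> where "\<S> = {S. S \<subseteq> W \<and> card S \<le> m \<and> (\<exists>L. ?good S L)}"
    have "finite \<S>" unfolding \<S>_def using finW by (auto intro: finite_subset[of _ "Pow W"])
    moreover have "{} \<in> \<S>"
      unfolding \<S>_def using fingerprint_link_empty[OF fin, of "M + M1" p D k "\<beta> / 2" G] pos M1_pos
      by (auto simp del: add_nonneg_nonneg)
    ultimately obtain S where S: "S \<in> \<S>" and S_max: "\<And>S'. S' \<in> \<S> \<Longrightarrow> S \<subseteq> S' \<Longrightarrow> S' = S"
      using finite_has_maximal2[of \<S> "{}"] by metis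
    have SW: "S \<subseteq> W" "S \<subseteq> V" "card S \<le> m" using S W by (auto simp: \<S>_def)
    have finS: "finite S" using finW SW finite_subset by auto
    have cardS: "real (card S) \<le> 2 * p * N" using SW(3) m(2) by linarith
    have "\<exists>L. ?good S L" using S by (simp add: \<S>_def)
    then have good: "?good S (link S)" unfolding link_def by (rule someI_ex)
    show "\<exists>Ss. length Ss = Suc k \<and> (\<forall>S\<in>set Ss. S \<subseteq> W \<and> real (card S) \<le> 2 * p * N) \<and>
           F Ss \<subseteq> V \<and> c * N \<le> real (card (F Ss)) \<and> real (card (W \<inter> F Ss)) \<le> 2 * p * N"
    proof (cases "p * N \<le> real (card S)")
      case True
      \<comment> \<open>At least \<open>p * N\<close> vertices, each adding
        \<open>\<beta> / 2 * D\<close>, make the link heavy enough for the induction at degree scale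
        \<open>p * D\<close>.\<close>
      have "\<beta> / 2 * (p * D) * N = p * N * (\<beta> / 2) * D" by simp
      also have "\<dots> \<le> real (card S) * (\<beta> / 2) * D"
        using True pos by (intro mult_right_mono) auto
      finally have "removes k c' \<xi>' V N p (p * D) (link S)"
        using good by (intro IH) (auto simp: fingerprint_link_def)
      moreover have "wt (link S) {} W \<le> \<xi>' * p ^ k * (p * D) * N"
      proof -
        have "wt (link S) {} W \<le> real (Suc k) * wt G {} W"
          by (rule wt_fingerprint_link_induced_le[OF G(1) good SW(1) W])
        also have "\<dots> \<le> real (Suc k) * (\<xi> * p ^ Suc k * D * N)" using wtW by (intro mult_left_mono) auto
        also have "\<dots> = (real (Suc k) * \<xi>) * (p ^ k * (p * D) * N)" by simp
        also have "\<dots> \<le> \<xi>' * (p ^ k * (p * D) * N)" using \<xi> pos by (intro mult_right_mono) auto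
        finally show ?thesis by (simp add: mult_ac)
      qed
      ultimately obtain Ss where "length Ss = k" "\<forall>S\<in>set Ss. S \<subseteq> W \<and> real (card S) \<le> 2 * p * N"
        "FL (link S) Ss \<subseteq> V" "c' * N \<le> real (card (FL (link S) Ss))"
        "real (card (W \<inter> FL (link S) Ss)) \<le> 2 * p * N"
        using FL[OF _ W] by blast
      moreover have "c * N \<le> c' * N" using c pos by simp
      ultimately show ?thesis using True SW(1) cardS
        by (intro exI[of _ "S # Ss"]) (auto simp: F_def)
    next
      case False
      \<comment> \<open>A rich vertex of \<open>W\<close> outside \<open>S\<close> could be added
        within \<open>\<S>\<close>, since \<open>card S < m\<close> leaves room; maximality forbids
        it.\<close>
      have small: "W \<inter> rich (link S) \<subseteq> S"
      proof
        fix w assume w: "w \<in> W \<inter> rich (link S)"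
        show "w \<in> S"
        proof (rule ccontr)
          assume "w \<notin> S"
          have "?good (insert w S) (\<lambda>e. link S e + open_link G (sat (link S)) w e)"
            by (rule fingerprint_link_insert[OF G good _ \<open>w \<notin> S\<close> SW(2)])
              (use w W pos in \<open>auto simp: sat_def rich_def\<close>)
          moreover have "card S < m" using False m(1) by linarith
          ultimately have "insert w S \<in> \<S>"
            using w SW(1) finS \<open>w \<notin> S\<close> by (auto simp: \<S>_def)
          then show False using S_max[of "insert w S"] \<open>w \<notin> S\<close> by auto
        qed
      qed
      have "c * N \<le> \<beta> / (4 * M) * N" using c pos by (intro mult_right_mono) auto
      also have "\<dots> \<le> real (card (rich (link S)))"
        unfolding rich_def
      proof (rule card_rich_ge[OF G N(1) wt])
        show "(\<Sum>T\<in>sat (link S). wt G T V) \<le> \<beta> / 4 * D * N"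
          unfolding sat_def by (rule sum_saturated_le[OF G good SW(2)]) (use False pos M1 in auto)
      qed (use pos in \<open>auto simp: sat_def saturated_def\<close>)
      finally have "c * N \<le> real (card (rich (link S)))" .
      moreover have "real (card (W \<inter> rich (link S))) \<le> 2 * p * N"
        using card_mono[OF finS small] cardS by linarith
      moreover have "rich (link S) \<subseteq> V" by (auto simp: rich_def)
      \<comment> \<open>The empty sets pad the list to length \<open>Suc k\<close>; in this case
        \<open>F\<close> reads only its head.\<close>
      ultimately show ?thesis using False SW(1) cardS pos
        by (intro exI[of _ "S # replicate k {}"]) (auto simp: F_def)
    qed
  qed
qed

text \<open>The constants are fixed before \<open>V\<close>, \<open>N\<close>, \<open>p\<close>,
  \<open>D\<close> and \<open>G\<close>. The link only satisfies the hypotheses with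
  \<open>\<beta> / 2\<close> and \<open>M + M1\<close>, so the induction on \<open>k\<close>
  generalises over \<open>\<beta>\<close> and \<open>M\<close>.\<close>

lemma removes_exists:
  fixes \<beta> M :: real
  assumes "\<beta> > 0" "M > 0"
  shows "\<exists>c>0. \<exists>\<xi>>0. \<forall>V N p D (G :: 'a set \<Rightarrow> real).
    uniform_weights k V G \<longrightarrow> degrees_le M V p D G \<longrightarrow> real (card V) \<le> N \<longrightarrow> 1 \<le> p * N \<longrightarrow>
    \<beta> * D * N \<le> wt G {} V \<longrightarrow> p > 0 \<longrightarrow> D > 0 \<longrightarrow> N > 0 \<longrightarrow> removes k c \<xi> V N p D G"
  using assms
proof (induction k arbitrary: \<beta> M)
  case 0
  have "\<forall>V N p D (G :: 'a set \<Rightarrow> real).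
    uniform_weights 0 V G \<longrightarrow> degrees_le M V p D G \<longrightarrow> real (card V) \<le> N \<longrightarrow> 1 \<le> p * N \<longrightarrow>
    \<beta> * D * N \<le> wt G {} V \<longrightarrow> p > 0 \<longrightarrow> D > 0 \<longrightarrow> N > 0 \<longrightarrow> removes 0 1 (\<beta> / 2) V N p D G"
    using 0 by (auto intro!: removes_0)
  moreover have "\<beta> / 2 > 0" using 0 by simp
  ultimately show ?case 
    by - (rule exI[of _ 1], rule conjI[OF zero_less_one], rule exI[of _ "\<beta> / 2"], rule conjI)
next
  case (Suc k)
  define M1 where "M1 = 2 ^ (k + 2) * M\<^sup>2 / \<beta>"
  have "M + M1 > 0" "\<beta> / 2 > 0" using Suc.prems by (auto simp: M1_def intro!: add_pos_pos)
  from Suc.IH[OF this(2,1)] obtain c' \<xi>' where *: "c' > 0" "\<xi>' > 0"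
    "\<And>V N p D (G :: 'a set \<Rightarrow> real). uniform_weights k V G \<Longrightarrow> degrees_le (M + M1) V p D G \<Longrightarrow>
      real (card V) \<le> N \<Longrightarrow> 1 \<le> p * N \<Longrightarrow> \<beta> / 2 * D * N \<le> wt G {} V \<Longrightarrow>
      p > 0 \<Longrightarrow> D > 0 \<Longrightarrow> N > 0 \<Longrightarrow> removes k c' \<xi>' V N p D G"
    by blast
  show ?case
  \<comment> \<open>The minimum covers the two kinds of removed set, one from the link and one
    consisting of rich vertices; \<open>Suc k\<close> is the loss in passing sparsity to the
    link.\<close>
  proof (rule exI[of _ "min c' (\<beta> / (4 * M))"], rule conjI[rotated],
      rule exI[of _ "\<xi>' / real (Suc k)"], intro conjI allI impI)
    fix V N p D and G :: "'a set \<Rightarrow> real"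
    assume a: "uniform_weights (Suc k) V G" "degrees_le M V p D G" "real (card V) \<le> N" "1 \<le> p * N"
      "\<beta> * D * N \<le> wt G {} V" "p > 0" "D > 0" "N > 0"
    show "removes (Suc k) (min c' (\<beta> / (4 * M))) (\<xi>' / real (Suc k)) V N p D G"
      by (rule removes_Suc[OF a(1-5) Suc.prems a(6-8) M1_def *(3)]) (use a in auto)
  qed (use * Suc.prems in auto)
qed

section \<open>Iterated removal and containers\<close>

definition restrict_weights :: "('a set \<Rightarrow> real) \<Rightarrow> 'a set \<Rightarrow> 'a set \<Rightarrow> real" where
  "restrict_weights G A e = (if e \<subseteq> A then G e else 0)"

lemma wt_restrict: "wt (restrict_weights G A) T A = wt G T A"
  unfolding wt_def restrict_weights_def by (rule sum.cong) auto

text \<open>As long as the current container has weight at least \<open>\<beta> * D * N\<close>,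
  another removal applies to it. Each round takes away at least \<open>c * N\<close> vertices and
  loses at most \<open>2 * p * N\<close> elements of \<open>W\<close>; the last alternative records
  the progress.\<close>

lemma container_iterate:
  fixes V :: "'a set"
  assumes G: "uniform_weights k V G" "degrees_le M V p D G"
    and N: "N = real (card V)" and pos: "p \<ge> 0" "N \<ge> 0"
    and rem: "\<And>A (G' :: 'a set \<Rightarrow> real). uniform_weights k A G' \<Longrightarrow> degrees_le M A p D G' \<Longrightarrow>
      real (card A) \<le> N \<Longrightarrow> \<beta> * D * N \<le> wt G' {} A \<Longrightarrow> removes k c \<xi> A N p D G'"
  shows "\<exists>Cn. \<forall>W\<subseteq>V. wt G {} W \<le> \<xi> * p ^ k * D * N \<longrightarrow>
    (\<exists>Ss. length Ss = m * k \<and> (\<forall>S\<in>set Ss. S \<subseteq> W \<and> real (card S) \<le> 2 * p * N) \<and>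
       Cn Ss \<subseteq> V \<and> real (card (W - Cn Ss)) \<le> real m * (2 * p * N) \<and>
       (wt G {} (Cn Ss) < \<beta> * D * N \<or> real (card (Cn Ss)) \<le> (1 - real m * c) * N))"
proof (induction m)
  case 0
  show ?case by (rule exI[of _ "\<lambda>_. V"]) (auto simp: N Diff_eq_empty_iff[THEN iffD2])
next
  case (Suc m)
  note fin = uniform_weights_finite[OF G(1)] and nn = uniform_weights_nonneg[OF G(1)]
  from Suc obtain Cn where Cn: "\<And>W. W \<subseteq> V \<Longrightarrow> wt G {} W \<le> \<xi> * p ^ k * D * N \<Longrightarrow>
    \<exists>Ss. length Ss = m * k \<and> (\<forall>S\<in>set Ss. S \<subseteq> W \<and> real (card S) \<le> 2 * p * N) \<and>
       Cn Ss \<subseteq> V \<and> real (card (W - Cn Ss)) \<le> real m * (2 * p * N) \<and>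
       (wt G {} (Cn Ss) < \<beta> * D * N \<or> real (card (Cn Ss)) \<le> (1 - real m * c) * N)"
    by blast
  define removal where "removal A F \<longleftrightarrow> (\<forall>W\<subseteq>A. wt (restrict_weights G A) {} W \<le> \<xi> * p ^ k * D * N \<longrightarrow>
        (\<exists>Ss. length Ss = k \<and> (\<forall>S\<in>set Ss. S \<subseteq> W \<and> real (card S) \<le> 2 * p * N) \<and>
           F Ss \<subseteq> A \<and> c * N \<le> real (card (F Ss)) \<and> real (card (W \<inter> F Ss)) \<le> 2 * p * N))" for A F
  have ex: "\<exists>F. removal A F" if A: "A \<subseteq> V" and wt: "\<beta> * D * N \<le> wt G {} A" for A
  proof -
    have "removes k c \<xi> A N p D (restrict_weights G A)"
    proof (rule rem)
      show "uniform_weights k A (restrict_weights G A)"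
        using G(1) A fin finite_subset by (auto simp: uniform_weights_def restrict_weights_def)
      show "degrees_le M A p D (restrict_weights G A)" unfolding degrees_le_def wt_restrict
      proof (intro allI impI)
        fix T assume T: "T \<noteq> {}" "T \<subseteq> A"
        have "wt G T A \<le> wt G T V" by (rule wt_mono) (use fin A nn in auto)
        also have "\<dots> \<le> M * D * p ^ (card T - 1)" using G(2) T A by (auto simp: degrees_le_def)
        finally show "wt G T A \<le> M * D * p ^ (card T - 1)" .
      qed
      show "real (card A) \<le> N" using A fin by (simp add: N card_mono)
      show "\<beta> * D * N \<le> wt (restrict_weights G A) {} A" using wt by (simp add: wt_restrict)
    qed
    then show ?thesis unfolding removes_def removal_def .
  qed
  \<comment> \<open>One removal function is fixed for each \<open>A\<close>, so that the next
    container depends on the list alone.\<close>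
  define F where "F A = (SOME F. removal A F)" for A
  have F: "removal A (F A)" if "A \<subseteq> V" "\<beta> * D * N \<le> wt G {} A" for A
    unfolding F_def using ex[OF that] by (rule someI_ex)
  \<comment> \<open>The first \<open>m * k\<close> entries determine the current container, the
    remaining \<open>k\<close> the set taken out of it.\<close>
  define Cn' where "Cn' Ss = (let A = Cn (take (m * k) Ss) in
    if wt G {} A < \<beta> * D * N then A else A - F A (drop (m * k) Ss))" for Ss
  show ?case
  proof (rule exI[of _ Cn'], intro allI impI)
    fix W assume W: "W \<subseteq> V" and wtW: "wt G {} W \<le> \<xi> * p ^ k * D * N"
    have finW: "finite W" using W fin finite_subset by auto
    obtain Ss where Ss: "length Ss = m * k" "\<forall>S\<in>set Ss. S \<subseteq> W \<and> real (card S) \<le> 2 * p * N"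
      "Cn Ss \<subseteq> V" "real (card (W - Cn Ss)) \<le> real m * (2 * p * N)"
      "wt G {} (Cn Ss) < \<beta> * D * N \<or> real (card (Cn Ss)) \<le> (1 - real m * c) * N"
      using Cn[OF W wtW] by blast
    let ?A = "Cn Ss"
    show "\<exists>Ss. length Ss = Suc m * k \<and> (\<forall>S\<in>set Ss. S \<subseteq> W \<and> real (card S) \<le> 2 * p * N) \<and>
       Cn' Ss \<subseteq> V \<and> real (card (W - Cn' Ss)) \<le> real (Suc m) * (2 * p * N) \<and>
       (wt G {} (Cn' Ss) < \<beta> * D * N \<or> real (card (Cn' Ss)) \<le> (1 - real (Suc m) * c) * N)"
    proof (cases "wt G {} ?A < \<beta> * D * N")
      case True
      have "Cn' (Ss @ replicate k {}) = ?A" using True Ss(1) by (simp add: Cn'_def Let_def)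
      moreover have "real m * (2 * p * N) \<le> real (Suc m) * (2 * p * N)"
        using pos by (intro mult_right_mono) auto
      ultimately show ?thesis using Ss True pos
        by (intro exI[of _ "Ss @ replicate k {}"]) (auto simp del: of_nat_Suc)
    next
      case False
      \<comment> \<open>Removal concerns subsets of the current container, so it is applied to
        \<open>W \<inter> ?A\<close>; the rest of \<open>W\<close> is already counted as
        lost.\<close>
      have "wt (restrict_weights G ?A) {} (W \<inter> ?A) \<le> wt G {} W"
        by (rule wt_mono) (use finW nn in \<open>auto simp: restrict_weights_def\<close>)
      then have wt': "wt (restrict_weights G ?A) {} (W \<inter> ?A) \<le> \<xi> * p ^ k * D * N" using wtW by linarith
      have "removal ?A (F ?A)" using F[OF Ss(3)] False by simp
      from this[unfolded removal_def, rule_format, OF Int_lower2 wt'] obtain Ts where Ts: "length Ts = k" "\<forall>S\<in>set Ts. S \<subseteq> W \<inter> ?A \<and> real (card S) \<le> 2 * p * N"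
        "F ?A Ts \<subseteq> ?A" "c * N \<le> real (card (F ?A Ts))"
        "real (card (W \<inter> ?A \<inter> F ?A Ts)) \<le> 2 * p * N"
        by blast
      have eq: "Cn' (Ss @ Ts) = ?A - F ?A Ts" using False Ss(1) by (simp add: Cn'_def Let_def)
      have finA: "finite ?A" using Ss(3) fin finite_subset by auto
      have "W - (?A - F ?A Ts) = (W - ?A) \<union> (W \<inter> ?A \<inter> F ?A Ts)" using Ts(3) by auto
      then have "card (W - (?A - F ?A Ts)) \<le> card (W - ?A) + card (W \<inter> ?A \<inter> F ?A Ts)"
        by (simp add: card_Un_le)
      then have "real (card (W - (?A - F ?A Ts))) \<le> real (Suc m) * (2 * p * N)"
        using Ss(4) Ts(5) by (simp add: algebra_simps)
      moreover have "real (card (?A - F ?A Ts)) \<le> (1 - real (Suc m) * c) * N"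
      proof -
        have "card (F ?A Ts) \<le> card ?A" using Ts(3) finA card_mono by blast
        then have "real (card (?A - F ?A Ts)) = real (card ?A) - real (card (F ?A Ts))"
          using Ts(3) finA by (simp add: card_Diff_subset finite_subset)
        then show ?thesis using Ss(5) False Ts(4) by (simp add: algebra_simps)
      qed
      ultimately show ?thesis using Ss(1-3) Ts
        by (intro exI[of _ "Ss @ Ts"]) (auto simp: eq simp del: of_nat_Suc)
    qed
  qed
qed

definition has_containers ::
  "nat \<Rightarrow> nat \<Rightarrow> nat \<Rightarrow> real \<Rightarrow> real \<Rightarrow> 'a set \<Rightarrow> real \<Rightarrow> real \<Rightarrow> ('a set \<Rightarrow> real) \<Rightarrow> bool" where
  "has_containers k r m \<xi> \<beta> V p D G \<longleftrightarrow>
    (\<exists>Cn. \<forall>W\<subseteq>V. wt G {} W \<le> \<xi> * p ^ k * D * real (card V) \<longrightarrow>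
      (\<exists>Ss. length Ss = r \<and> (\<forall>S\<in>set Ss. S \<subseteq> W \<and> real (card S) \<le> 2 * p * real (card V)) \<and>
         Cn Ss \<subseteq> V \<and> real (card (W - Cn Ss)) \<le> real m * (2 * p * real (card V)) \<and>
         wt G {} (Cn Ss) < \<beta> * D * real (card V)))"

text \<open>After more than \<open>1 / c\<close> rounds a container that is still not sparse would
  have negative cardinality.\<close>

lemma sparse_set_containers:
  fixes \<beta> M :: real
  assumes "\<beta> > 0" "M > 0"
  shows "\<exists>r m \<xi>. \<xi> > 0 \<and> (\<forall>V p D (G :: 'a set \<Rightarrow> real).
    uniform_weights k V G \<longrightarrow> degrees_le M V p D G \<longrightarrow> 1 \<le> p * real (card V) \<longrightarrow> p > 0 \<longrightarrow> D > 0 \<longrightarrow>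
    has_containers k r m \<xi> \<beta> V p D G)"
proof -
  obtain c \<xi> where c: "c > 0" "\<xi> > 0" and rem: "\<And>V N p D (G :: 'a set \<Rightarrow> real).
    uniform_weights k V G \<Longrightarrow> degrees_le M V p D G \<Longrightarrow> real (card V) \<le> N \<Longrightarrow> 1 \<le> p * N \<Longrightarrow>
    \<beta> * D * N \<le> wt G {} V \<Longrightarrow> p > 0 \<Longrightarrow> D > 0 \<Longrightarrow> N > 0 \<Longrightarrow> removes k c \<xi> V N p D G"
    using removes_exists[OF assms, of k, where 'a='a] by blast
  define m where "m = nat \<lceil>1 / c\<rceil> + 1"
  have "1 / c < real m" unfolding m_def by linarith
  then have mc: "1 - real m * c < 0" using c by (simp add: field_simps)
  show ?thesis
  proof (rule exI[of _ "m * k"], rule exI[of _ m], rule exI[of _ \<xi>], intro conjI allI impI c(2))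
    fix V p D and G :: "'a set \<Rightarrow> real"
    assume a: "uniform_weights k V G" "degrees_le M V p D G" "1 \<le> p * real (card V)" "p > 0" "D > 0"
    have N: "real (card V) > 0" using a(3) by (cases "card V = 0") auto
    have "\<exists>Cn. \<forall>W\<subseteq>V. wt G {} W \<le> \<xi> * p ^ k * D * real (card V) \<longrightarrow>
      (\<exists>Ss. length Ss = m * k \<and> (\<forall>S\<in>set Ss. S \<subseteq> W \<and> real (card S) \<le> 2 * p * real (card V)) \<and>
       Cn Ss \<subseteq> V \<and> real (card (W - Cn Ss)) \<le> real m * (2 * p * real (card V)) \<and>
       (wt G {} (Cn Ss) < \<beta> * D * real (card V) \<or> real (card (Cn Ss)) \<le> (1 - real m * c) * real (card V)))"
      by (rule container_iterate[OF a(1,2) refl]) (use a N in \<open>auto intro!: rem\<close>)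
    moreover have "\<not> real (card A) \<le> (1 - real m * c) * real (card V)" for A :: "'a set"
      using mult_neg_pos[OF mc N] of_nat_0_le_iff[of "card A", where 'a=real] by linarith
    ultimately show "has_containers k (m * k) m \<xi> \<beta> V p D G"
      unfolding has_containers_def by simp
  qed
qed

subsection \<open>Random subsets\<close>

lemma set_pmf_random_subset: "set_pmf (random_subset V q) \<subseteq> Pow V"
  by (auto simp: random_subset_def)

lemma integrable_random_subset:
  fixes f :: "'a set \<Rightarrow> real"
  assumes "finite V"
  shows "integrable (measure_pmf (random_subset V q)) f"
  by (rule integrable_measure_pmf_finite)
     (rule finite_subset[OF set_pmf_random_subset], use assms in simp)

lemma expectation_random_subset_prod:
  fixes g :: "'a \<Rightarrow> bool \<Rightarrow> real"
  assumes V: "finite V" and q: "0 \<le> q" "q \<le> 1"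
    and nonneg: "\<And>v b. 0 \<le> g v b"
  shows "measure_pmf.expectation (random_subset V q) (\<lambda>R. \<Prod>v\<in>V. g v (v \<in> R)) =
    (\<Prod>v\<in>V. q * g v True + (1 - q) * g v False)"
proof -
  have "measure_pmf.expectation (random_subset V q) (\<lambda>R. \<Prod>v\<in>V. g v (v \<in> R)) =
      measure_pmf.expectation (Pi_pmf V False (\<lambda>_. bernoulli_pmf q)) (\<lambda>f. \<Prod>v\<in>V. g v (f v))"
    unfolding random_subset_def integral_map_pmf by (intro Bochner_Integration.integral_cong prod.cong) auto
  also have "\<dots> = (\<Prod>v\<in>V. measure_pmf.expectation (bernoulli_pmf q) (g v))"
    using V nonneg by (intro expectation_prod_Pi_pmf) (auto intro: integrable_measure_pmf_finite)
  also have "\<dots> = (\<Prod>v\<in>V. q * g v True + (1 - q) * g v False)"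
    using q by (intro prod.cong) (auto simp: mult_ac)
  finally show ?thesis .
qed

lemma prob_subset_random_subset:
  assumes V: "finite V" and q: "0 \<le> q" "q \<le> 1" and S: "S \<subseteq> V"
  shows "measure_pmf.prob (random_subset V q) {R. S \<subseteq> R} = q ^ card S"
proof -
  let ?g = "\<lambda>v b. if v \<in> S \<and> \<not> b then 0 else (1 :: real)"
  have ind: "indicat_real {R. S \<subseteq> R} R = (\<Prod>v\<in>V. ?g v (v \<in> R))" for R
  proof (cases "S \<subseteq> R")
    case True
    then have "(\<Prod>v\<in>V. ?g v (v \<in> R)) = 1" by (intro prod.neutral) auto
    then show ?thesis using True by simp
  next
    case False
    then have "(\<Prod>v\<in>V. ?g v (v \<in> R)) = 0" using S V by (intro prod_zero) auto
    then show ?thesis using False by simp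
  qed
  have "measure_pmf.prob (random_subset V q) {R. S \<subseteq> R} =
      measure_pmf.expectation (random_subset V q) (indicat_real {R. S \<subseteq> R})" by simp
  also have "\<dots> = measure_pmf.expectation (random_subset V q) (\<lambda>R. \<Prod>v\<in>V. ?g v (v \<in> R))"
    unfolding ind ..
  also have "\<dots> = (\<Prod>v\<in>V. q * ?g v True + (1 - q) * ?g v False)"
    by (rule expectation_random_subset_prod[OF V q]) auto
  also have "\<dots> = (\<Prod>v\<in>V. if v \<in> S then q else 1)" by (rule prod.cong) auto
  also have "\<dots> = q ^ card S" using V S by (simp add: prod.If_cases Int_absorb1)
  finally show ?thesis .
qed

text \<open>Markov's inequality for \<open>exp (l * card (R \<inter> X))\<close> restricted to the
  event \<open>S \<subseteq> R\<close>. The joint treatment keeps the factor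
  \<open>q ^ card S\<close> although \<open>S\<close> and \<open>X\<close> may overlap, at the price
  of \<open>exp l\<close> for each vertex of \<open>S\<close>.\<close>

lemma prob_random_subset_tail:
  assumes V: "finite V" and q: "0 \<le> q" "q \<le> 1" and S: "S \<subseteq> V" and X: "X \<subseteq> V" and l: "l \<ge> 0"
  shows "measure_pmf.prob (random_subset V q) {R. S \<subseteq> R \<and> a \<le> real (card (R \<inter> X))} \<le>
    exp (- l * a) * ((q * exp l) ^ card S * exp (q * (exp l - 1) * real (card X)))"
proof -
  define g where "g v b = (if v \<in> S \<and> \<not> b then 0 else if v \<in> X \<and> b then exp l else 1)" for v b
  let ?M = "random_subset V q"
  have pt: "indicat_real {R. S \<subseteq> R \<and> a \<le> real (card (R \<inter> X))} R \<le>
      exp (- l * a) * (\<Prod>v\<in>V. g v (v \<in> R))" if R: "R \<subseteq> V" for R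
  proof (cases "S \<subseteq> R \<and> a \<le> real (card (R \<inter> X))")
    case True
    have "(\<Prod>v\<in>V. g v (v \<in> R)) = (\<Prod>v\<in>V. if v \<in> R \<inter> X then exp l else 1)"
      by (rule prod.cong) (use True in \<open>auto simp: g_def\<close>)
    also have "\<dots> = (\<Prod>v\<in>R \<inter> X. exp l)"
      by (rule prod.mono_neutral_cong_right) (use V R in auto)
    also have "\<dots> = exp l ^ card (R \<inter> X)" by simp
    also have "\<dots> = exp (l * real (card (R \<inter> X)))" by (simp add: exp_of_nat2_mult)
    finally have "exp (- l * a) * (\<Prod>v\<in>V. g v (v \<in> R)) = exp (l * (real (card (R \<inter> X)) - a))"
      by (simp add: exp_add[symmetric] algebra_simps)
    moreover have "0 \<le> l * (real (card (R \<inter> X)) - a)" using True l by simp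
    ultimately show ?thesis using True by simp
  next
    case False
    have "0 \<le> (\<Prod>v\<in>V. g v (v \<in> R))" by (rule prod_nonneg) (auto simp: g_def)
    then show ?thesis using False by simp
  qed
  have "measure_pmf.prob ?M {R. S \<subseteq> R \<and> a \<le> real (card (R \<inter> X))} =
      measure_pmf.expectation ?M (indicat_real {R. S \<subseteq> R \<and> a \<le> real (card (R \<inter> X))})"
    by simp
  also have "\<dots> \<le> measure_pmf.expectation ?M (\<lambda>R. exp (- l * a) * (\<Prod>v\<in>V. g v (v \<in> R)))"
    by (rule integral_mono_AE[OF integrable_random_subset[OF V] integrable_random_subset[OF V]])
       (use pt set_pmf_random_subset[of V q] in \<open>auto simp: AE_measure_pmf_iff\<close>)
  also have "\<dots> = exp (- l * a) * (\<Prod>v\<in>V. q * g v True + (1 - q) * g v False)"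
    by (subst expectation_random_subset_prod[OF V q, symmetric]) (auto simp: g_def)
  also have "\<dots> \<le> exp (- l * a) * (\<Prod>v\<in>V. (if v \<in> S then q * exp l else 1) *
      (if v \<in> X then exp (q * (exp l - 1)) else 1))"
  proof (intro mult_left_mono prod_mono conjI)
    fix v
    show "0 \<le> q * g v True + (1 - q) * g v False" using q by (auto simp: g_def)
    have el: "1 \<le> exp l" using l by simp
    then have qe: "1 \<le> exp (q * (exp l - 1))" using q by simp
    have e1: "1 + q * (exp l - 1) \<le> exp (q * (exp l - 1))" by (rule exp_ge_add_one_self)
    \<comment> \<open>The factors are overestimated on \<open>S\<close>, so that the bound depends
      only on the cardinalities of \<open>S\<close> and \<open>X\<close> and not on their
      overlap.\<close>
    consider "v \<in> S" "v \<in> X" | "v \<in> S" "v \<notin> X" | "v \<notin> S" "v \<in> X" | "v \<notin> S" "v \<notin> X" by blast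
    then show "q * g v True + (1 - q) * g v False \<le> (if v \<in> S then q * exp l else 1) *
      (if v \<in> X then exp (q * (exp l - 1)) else 1)"
    proof cases
      case 1
      then show ?thesis using mult_left_mono[OF qe, of "q * exp l"] q by (simp add: g_def)
    next
      case 2
      then show ?thesis using mult_left_mono[OF el, of q] q by (simp add: g_def)
    next
      case 3
      then show ?thesis using e1 by (simp add: g_def algebra_simps)
    next
      case 4
      then show ?thesis by (simp add: g_def)
    qed
  qed auto
  also have "(\<Prod>v\<in>V. (if v \<in> S then q * exp l else 1) * (if v \<in> X then exp (q * (exp l - 1)) else 1)) =
      (q * exp l) ^ card S * exp (q * (exp l - 1)) ^ card X"
    using V by (simp add: prod.distrib prod.If_cases Int_absorb1[OF S] Int_absorb1[OF X])
  also have "exp (q * (exp l - 1)) ^ card X = exp (q * (exp l - 1) * real (card X))"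
    by (simp add: exp_of_nat2_mult)
  finally show ?thesis .
qed

section \<open>Degrees of sets from second moments\<close>

text \<open>For each pair fix a common vertex \<open>v\<close> and a set \<open>T\<close> of
  \<open>i\<close> further common elements. The random set contains \<open>T\<close> with
  probability \<open>q ^ i\<close>, and then both edges are counted by the degree of
  \<open>v\<close>, so the pair contributes to its square.\<close>

lemma mu_ge_pairs:
  assumes H: "uniform_hypergraph k H" and q: "0 \<le> q" "q \<le> 1"
  shows "q ^ i * real (card {(e, e'). e \<in> edges H \<and> e' \<in> edges H \<and> i < card (e \<inter> e')}) \<le> mu i H q"
proof -
  let ?V = "verts H" let ?E = "edges H" let ?M = "random_subset (verts H) q"
  define P where "P = {(e, e'). e \<in> ?E \<and> e' \<in> ?E \<and> i < card (e \<inter> e')}"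
  have V: "finite ?V" and EV: "\<And>e. e \<in> ?E \<Longrightarrow> e \<subseteq> ?V" using H by (auto simp: uniform_hypergraph_def)
  have E: "finite ?E" by (rule finite_subset[of _ "Pow ?V"]) (use V EV in auto)
  have P: "finite P" by (rule finite_subset[of _ "?E \<times> ?E"]) (use E in \<open>auto simp: P_def\<close>)
  have "\<forall>x\<in>P. \<exists>v T. v \<in> fst x \<inter> snd x \<and> T \<subseteq> fst x \<inter> snd x - {v} \<and> card T = i"
  proof
    fix x assume "x \<in> P"
    then have x: "fst x \<in> ?E" "i < card (fst x \<inter> snd x)" by (auto simp: P_def)
    then have fin: "finite (fst x \<inter> snd x)" using EV V finite_subset by blast
    obtain v where v: "v \<in> fst x \<inter> snd x" using x(2) by (metis card.empty ex_in_conv not_less0)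
    have "i \<le> card (fst x \<inter> snd x - {v})" using x(2) v fin by simp
    then show "\<exists>v T. v \<in> fst x \<inter> snd x \<and> T \<subseteq> fst x \<inter> snd x - {v} \<and> card T = i"
      using v by (meson obtain_subset_with_card_n)
  qed
  then obtain v T where vT: "\<And>x. x \<in> P \<Longrightarrow> v x \<in> fst x \<inter> snd x \<and> T x \<subseteq> fst x \<inter> snd x - {v x} \<and> card (T x) = i"
    by metis
  have TV: "T x \<subseteq> ?V" if "x \<in> P" for x using vT[OF that] that EV by (fastforce simp: P_def)
  have "q ^ i * real (card P) = (\<Sum>x\<in>P. measure_pmf.prob ?M {R. T x \<subseteq> R})"
    using vT TV by (simp add: prob_subset_random_subset[OF V q] mult.commute)
  also have "\<dots> = (\<Sum>x\<in>P. measure_pmf.expectation ?M (indicat_real {R. T x \<subseteq> R}))" by simp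
  also have "\<dots> = measure_pmf.expectation ?M (\<lambda>R. \<Sum>x\<in>P. indicat_real {R. T x \<subseteq> R} R)"
    by (rule Bochner_Integration.integral_sum[symmetric]) (rule integrable_random_subset[OF V])
  also have "\<dots> \<le> mu i H q" unfolding mu_def
  proof (rule integral_mono[OF integrable_random_subset[OF V] integrable_random_subset[OF V]])
    fix R
    define Ev where "Ev u = {e \<in> ?E. u \<in> e \<and> i \<le> card (e \<inter> (R - {u}))}" for u
    have fEv: "finite (Ev u)" for u using E by (simp add: Ev_def)
    have "(\<Sum>x\<in>P. indicat_real {R. T x \<subseteq> R} R) = real (card {x \<in> P. T x \<subseteq> R})"
      using P by (simp add: indicator_def sum.If_cases Int_def)
    also have "\<dots> \<le> real (card (SIGMA u:?V. Ev u \<times> Ev u))"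
    proof -
      have "(\<lambda>x. (v x, x)) ` {x \<in> P. T x \<subseteq> R} \<subseteq> (SIGMA u:?V. Ev u \<times> Ev u)"
      proof
        fix y assume "y \<in> (\<lambda>x. (v x, x)) ` {x \<in> P. T x \<subseteq> R}"
        then obtain x where x: "x \<in> P" "T x \<subseteq> R" "y = (v x, x)" by auto
        have e: "fst x \<in> ?E" "snd x \<in> ?E" using x(1) by (auto simp: P_def)
        have "i \<le> card (e \<inter> (R - {v x}))" if "e \<in> {fst x, snd x}" for e
        proof -
          have "finite e" using that e EV V finite_subset by blast
          moreover have "T x \<subseteq> e \<inter> (R - {v x})" using vT[OF x(1)] x(2) that by auto
          ultimately show ?thesis using vT[OF x(1)] by (metis card_mono finite_Int)
        qed
        then have "fst x \<in> Ev (v x)" "snd x \<in> Ev (v x)" using e vT[OF x(1)] by (auto simp: Ev_def)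
        moreover have "v x \<in> ?V" using vT[OF x(1)] e EV by auto
        ultimately show "y \<in> (SIGMA u:?V. Ev u \<times> Ev u)" using x(3) by (simp add: mem_Times_iff)
      qed
      moreover have "inj_on (\<lambda>x. (v x, x)) {x \<in> P. T x \<subseteq> R}" by (auto simp: inj_on_def)
      moreover have "finite (SIGMA u:?V. Ev u \<times> Ev u)" using V fEv by auto
      ultimately show ?thesis by (simp only: of_nat_le_iff card_inj_on_le)
    qed
    also have "\<dots> = (\<Sum>u\<in>?V. (real (deg i H u R))\<^sup>2)"
      using V fEv by (simp add: card_SigmaI card_cartesian_product deg_def Ev_def power2_eq_square)
    finally show "(\<Sum>x\<in>P. indicat_real {R. T x \<subseteq> R} R) \<le> (\<Sum>u\<in>?V. (real (deg i H u R))\<^sup>2)" .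
  qed
  finally show ?thesis by (simp add: P_def)
qed

text \<open>The squares count triples of a set \<open>T\<close> and two edges above it. Such a
  \<open>T\<close> exists only if the edges share more than \<open>i\<close> elements, and then
  there are at most \<open>2 ^ k\<close> of them.\<close>

lemma sum_degree_squares_le:
  assumes H: "uniform_hypergraph k H" and q: "0 \<le> q" "q \<le> 1"
  shows "q ^ i * (\<Sum>T | T \<subseteq> verts H \<and> card T = Suc i. (real (card {e \<in> edges H. T \<subseteq> e}))\<^sup>2)
    \<le> 2 ^ k * mu i H q"
proof -
  let ?V = "verts H" let ?E = "edges H"
  let ?\<T> = "{T. T \<subseteq> verts H \<and> card T = Suc i}"
  have V: "finite ?V" and EV: "\<And>e. e \<in> ?E \<Longrightarrow> e \<subseteq> ?V" and Ek: "\<And>e. e \<in> ?E \<Longrightarrow> card e = k"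
    using H by (auto simp: uniform_hypergraph_def)
  have E: "finite ?E" by (rule finite_subset[of _ "Pow ?V"]) (use V EV in auto)
  have \<T>: "finite ?\<T>" by (rule finite_subset[of _ "Pow ?V"]) (use V in auto)
  have sq: "(real (card {e \<in> ?E. T \<subseteq> e}))\<^sup>2 =
      (\<Sum>x\<in>?E \<times> ?E. if T \<subseteq> fst x \<inter> snd x then 1 else 0)" for T
  proof -
    have "(\<Sum>x\<in>?E \<times> ?E. if T \<subseteq> fst x \<inter> snd x then 1 else (0::real)) =
        real (card (?E \<times> ?E \<inter> {x. T \<subseteq> fst x \<inter> snd x}))"
      using E by (subst sum.If_cases) auto
    also have "?E \<times> ?E \<inter> {x. T \<subseteq> fst x \<inter> snd x} = {e \<in> ?E. T \<subseteq> e} \<times> {e \<in> ?E. T \<subseteq> e}" by auto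
    finally show ?thesis by (simp add: card_cartesian_product power2_eq_square)
  qed
  have "(\<Sum>T\<in>?\<T>. (real (card {e \<in> ?E. T \<subseteq> e}))\<^sup>2) =
      (\<Sum>x\<in>?E \<times> ?E. \<Sum>T\<in>?\<T>. if T \<subseteq> fst x \<inter> snd x then 1 else 0)"
    unfolding sq by (rule sum.swap)
  also have "\<dots> \<le> (\<Sum>x\<in>?E \<times> ?E. if i < card (fst x \<inter> snd x) then 2 ^ k else 0)"
  proof (rule sum_mono)
    fix x assume x: "x \<in> ?E \<times> ?E"
    then have fin: "finite (fst x \<inter> snd x)" "finite (fst x)"
      using finite_subset[OF EV V, of "fst x"] by (auto simp: mem_Times_iff)
    have "(\<Sum>T\<in>?\<T>. if T \<subseteq> fst x \<inter> snd x then 1 else (0::real)) =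
        real (card (?\<T> \<inter> {T. T \<subseteq> fst x \<inter> snd x}))"
      using \<T> by (subst sum.If_cases) auto
    also have "\<dots> \<le> (if i < card (fst x \<inter> snd x) then 2 ^ k else 0)"
    proof (cases "i < card (fst x \<inter> snd x)")
      case True
      have "card (?\<T> \<inter> {T. T \<subseteq> fst x \<inter> snd x}) \<le> card (Pow (fst x))"
        using fin by (intro card_mono) auto
      also have "\<dots> = 2 ^ k" using fin x Ek by (simp add: card_Pow mem_Times_iff)
      finally have "real (card (?\<T> \<inter> {T. T \<subseteq> fst x \<inter> snd x})) \<le> real (2 ^ k)" by (simp only: of_nat_le_iff)
      then show ?thesis using True by simp
    next
      case False
      have "card T \<noteq> Suc i" if "T \<subseteq> fst x \<inter> snd x" for T
        using card_mono[OF fin(1) that] False by linarith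
      then have "?\<T> \<inter> {T. T \<subseteq> fst x \<inter> snd x} = {}" by blast
      then show ?thesis using False by simp
    qed
    finally show "(\<Sum>T\<in>?\<T>. if T \<subseteq> fst x \<inter> snd x then 1 else (0::real)) \<le>
      (if i < card (fst x \<inter> snd x) then 2 ^ k else 0)" .
  qed
  also have "\<dots> = 2 ^ k * real (card {(e, e'). e \<in> ?E \<and> e' \<in> ?E \<and> i < card (e \<inter> e')})"
  proof -
    have "?E \<times> ?E \<inter> {x. i < card (fst x \<inter> snd x)} =
        {(e, e'). e \<in> ?E \<and> e' \<in> ?E \<and> i < card (e \<inter> e')}" by auto
    then show ?thesis using E by (subst sum.If_cases) auto
  qed
  finally have "q ^ i * (\<Sum>T\<in>?\<T>. (real (card {e \<in> ?E. T \<subseteq> e}))\<^sup>2) \<le>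
      q ^ i * (2 ^ k * real (card {(e, e'). e \<in> ?E \<and> e' \<in> ?E \<and> i < card (e \<inter> e')}))"
    using q by (intro mult_left_mono) auto
  also have "\<dots> = 2 ^ k * (q ^ i * real (card {(e, e'). e \<in> ?E \<and> e' \<in> ?E \<and> i < card (e \<inter> e')}))"
    by simp
  also have "\<dots> \<le> 2 ^ k * mu i H q" using mu_ge_pairs[OF H q] by (intro mult_left_mono) auto
  finally show ?thesis .
qed

subsection \<open>Pruning and the union bound\<close>

text \<open>All edges above a set of too large degree are deleted. As such a degree exceeds
  \<open>M * D * p ^ i\<close>, where \<open>i + 1\<close> is the size of the set, the degrees are
  bounded by their squares divided by this number. The moment bound then limits the loss to a
  fraction \<open>2 ^ k * K / M\<close> of the edges for each \<open>i < k\<close>.\<close>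

lemma prune_heavy_edges:
  fixes H :: "'a hypergraph"
  assumes H: "uniform_hypergraph k H"
    and mu: "\<And>i. i < k \<Longrightarrow>
      mu i H p \<le> K * p ^ (2 * i) * (real (card (edges H)))\<^sup>2 / real (card (verts H))"
    and p: "0 < p" "p \<le> 1" and M: "M > 0"
    and E_pos: "card (edges H) > 0" and V_pos: "card (verts H) > 0"
    and D: "D = real (card (edges H)) / real (card (verts H))"
  shows "\<exists>G. uniform_weights k (verts H) G \<and> degrees_le M (verts H) p D G \<and>
    (\<forall>W\<subseteq>verts H. wt G {} W \<le> real (card {e \<in> edges H. e \<subseteq> W})) \<and>
    (\<forall>W\<subseteq>verts H. real (card {e \<in> edges H. e \<subseteq> W}) \<le> wt G {} W + real k * 2 ^ k * K / M * real (card (edges H)))"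
proof -
  let ?V = "verts H" let ?E = "edges H"
  have V: "finite ?V" and EV: "\<And>e. e \<in> ?E \<Longrightarrow> e \<subseteq> ?V" and Ek: "\<And>e. e \<in> ?E \<Longrightarrow> card e = k"
    using H by (auto simp: uniform_hypergraph_def)
  have E: "finite ?E" using E_pos by (rule card_ge_0_finite)
  have D_pos: "D > 0" using E_pos V_pos by (simp add: D)
  define d where "d T = real (card {e \<in> ?E. T \<subseteq> e})" for T
  define heavy where "heavy = {T. T \<noteq> {} \<and> T \<subseteq> ?V \<and> M * D * p ^ (card T - 1) < d T}"
  define light where "light = {e \<in> ?E. \<not> (\<exists>T\<in>heavy. T \<subseteq> e)}"
  define G where "G e = (if e \<in> light then 1 else (0::real))" for e
  have light: "finite light" "light \<subseteq> ?E" using E by (auto simp: light_def)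
  have heavy: "finite heavy" by (rule finite_subset[of _ "Pow ?V"]) (use V in \<open>auto simp: heavy_def\<close>)
  have wt_G: "wt G T W = real (card {e \<in> light. T \<subseteq> e \<and> e \<subseteq> W})" if "W \<subseteq> ?V" for T W
  proof -
    have "wt G T W = (\<Sum>e\<in>{e \<in> light. T \<subseteq> e \<and> e \<subseteq> W}. 1)"
      unfolding wt_def
      by (rule sum.mono_neutral_cong_right)
         (use finite_wt_index[OF finite_subset[OF that V]] in \<open>auto simp: G_def\<close>)
    then show ?thesis by simp
  qed
  have "uniform_weights k ?V G"
    using V EV Ek light by (auto simp: uniform_weights_def G_def)
  moreover have "degrees_le M ?V p D G" unfolding degrees_le_def
  proof (intro allI impI)
    fix T assume T: "T \<noteq> {}" "T \<subseteq> ?V"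
    show "wt G T ?V \<le> M * D * p ^ (card T - 1)"
    proof (cases "T \<in> heavy")
      case True
      then have "{e \<in> light. T \<subseteq> e \<and> e \<subseteq> ?V} = {}" by (auto simp: light_def)
      then show ?thesis using M D_pos p by (simp only: wt_G[OF order_refl] card.empty) simp
    next
      case False
      have "wt G T ?V \<le> d T"
        unfolding wt_G[OF order_refl] d_def using E light by (auto intro!: card_mono)
      then show ?thesis using False T by (auto simp: heavy_def)
    qed
  qed
  moreover have "wt G {} W \<le> real (card {e \<in> ?E. e \<subseteq> W})" if "W \<subseteq> ?V" for W
    unfolding wt_G[OF that] using E light by (auto intro!: card_mono)
  moreover have "real (card {e \<in> ?E. e \<subseteq> W}) \<le> wt G {} W + real k * 2 ^ k * K / M * real (card ?E)"
    if W: "W \<subseteq> ?V" for W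
  proof -
    have "{e \<in> ?E. e \<subseteq> W} \<subseteq> {e \<in> light. e \<subseteq> W} \<union> (\<Union>T\<in>heavy. {e \<in> ?E. T \<subseteq> e})"
      by (auto simp: light_def)
    then have "card {e \<in> ?E. e \<subseteq> W} \<le> card ({e \<in> light. e \<subseteq> W} \<union> (\<Union>T\<in>heavy. {e \<in> ?E. T \<subseteq> e}))"
      using light heavy E by (intro card_mono) auto
    also have "\<dots> \<le> card {e \<in> light. e \<subseteq> W} + card (\<Union>T\<in>heavy. {e \<in> ?E. T \<subseteq> e})"
      by (rule card_Un_le)
    also have "\<dots> \<le> card {e \<in> light. e \<subseteq> W} + (\<Sum>T\<in>heavy. card {e \<in> ?E. T \<subseteq> e})"
      using card_UN_le[OF heavy] by simp
    finally have "real (card {e \<in> ?E. e \<subseteq> W}) \<le>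
        real (card {e \<in> light. e \<subseteq> W} + (\<Sum>T\<in>heavy. card {e \<in> ?E. T \<subseteq> e}))"
      by (simp only: of_nat_le_iff)
    then have split: "real (card {e \<in> ?E. e \<subseteq> W}) \<le> wt G {} W + (\<Sum>T\<in>heavy. d T)"
      by (simp add: wt_G[OF W] d_def)
    \<comment> \<open>A heavy set is nonempty and lies in some edge, so \<open>card T - 1\<close> is
      one of the indices with a moment bound.\<close>
    have heavy_card: "card T - 1 < k" if "T \<in> heavy" for T
    proof -
      have "0 < d T" using that M D_pos p unfolding heavy_def
        by (smt (verit) mem_Collect_eq mult_pos_pos zero_less_power)
      then obtain e where e: "e \<in> ?E" "T \<subseteq> e" by (auto simp: d_def card_gt_0_iff)
      have fin: "finite e" using EV[OF e(1)] V finite_subset by blast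
      have "T \<noteq> {}" using that by (simp add: heavy_def)
      then have "0 < card T" using e(2) fin finite_subset by (auto simp: card_gt_0_iff)
      moreover have "card T \<le> k" using card_mono[OF fin e(2)] Ek[OF e(1)] by simp
      ultimately show ?thesis by linarith
    qed
    have "(\<Sum>T\<in>heavy. d T) = (\<Sum>i<k. \<Sum>T\<in>{T \<in> heavy. card T - 1 = i}. d T)"
      by (rule sum.group[symmetric]) (use heavy heavy_card in auto)
    also have "\<dots> \<le> (\<Sum>i<k. 2 ^ k * K / M * real (card ?E))"
    proof (rule sum_mono)
      fix i assume i: "i \<in> {..<k}"
      have MDp: "0 < M * D * p ^ i" using M D_pos p by simp
      have "(\<Sum>T\<in>{T \<in> heavy. card T - 1 = i}. d T) \<le>
          (\<Sum>T\<in>{T \<in> heavy. card T - 1 = i}. (d T)\<^sup>2 / (M * D * p ^ i))"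
      proof (rule sum_mono)
        fix T assume "T \<in> {T \<in> heavy. card T - 1 = i}"
        then have "M * D * p ^ i \<le> d T" by (auto simp: heavy_def)
        then have "M * D * p ^ i * d T \<le> d T * d T" by (rule mult_right_mono) (simp add: d_def)
        then show "d T \<le> (d T)\<^sup>2 / (M * D * p ^ i)"
          using MDp by (simp add: pos_le_divide_eq power2_eq_square mult.commute)
      qed
      also have "\<dots> \<le> (\<Sum>T | T \<subseteq> ?V \<and> card T = Suc i. (d T)\<^sup>2 / (M * D * p ^ i))"
      proof (rule sum_mono2)
        show "finite {T. T \<subseteq> ?V \<and> card T = Suc i}" by (rule finite_subset[of _ "Pow ?V"]) (use V in auto)
        show "{T \<in> heavy. card T - 1 = i} \<subseteq> {T. T \<subseteq> ?V \<and> card T = Suc i}"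
        proof
          fix T assume T: "T \<in> {T \<in> heavy. card T - 1 = i}"
          then have "T \<subseteq> ?V" "T \<noteq> {}" by (auto simp: heavy_def)
          then have "0 < card T" using V finite_subset by (auto simp: card_gt_0_iff)
          then show "T \<in> {T. T \<subseteq> ?V \<and> card T = Suc i}" using T \<open>T \<subseteq> ?V\<close> by auto
        qed
      qed (use MDp in auto)
      \<comment> \<open>Expanding the fraction by \<open>p ^ i\<close> produces the left side of
        \<open>sum_degree_squares_le\<close>.\<close>
      also have "\<dots> = (p ^ i * (\<Sum>T | T \<subseteq> ?V \<and> card T = Suc i. (d T)\<^sup>2)) / (M * D * p ^ (2 * i))"
        using p by (simp add: sum_divide_distrib[symmetric] mult_2 power_add)
      also have "\<dots> \<le> (2 ^ k * mu i H p) / (M * D * p ^ (2 * i))"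
        using sum_degree_squares_le[OF H, of p i] p M D_pos
        by (intro divide_right_mono) (auto simp: d_def)
      also have "\<dots> \<le> (2 ^ k * (K * p ^ (2 * i) * (real (card ?E))\<^sup>2 / real (card ?V))) / (M * D * p ^ (2 * i))"
        using mu[of i] i p M D_pos by (intro divide_right_mono mult_left_mono) auto
      also have "\<dots> = 2 ^ k * K / M * real (card ?E)"
        using p M E_pos V_pos by (simp add: D field_simps power2_eq_square)
      finally show "(\<Sum>T\<in>{T \<in> heavy. card T - 1 = i}. d T) \<le> 2 ^ k * K / M * real (card ?E)" .
    qed
    also have "\<dots> = real k * 2 ^ k * K / M * real (card ?E)" by simp
    finally show ?thesis using split by linarith
  qed
  ultimately show ?thesis by blast
qed

text \<open>The restriction to small unions is paid for by the factor \<open>\<theta>\<^bsup>|S|-s\<^esup> \<ge> 1\<close>, after which the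
  sum over all \<open>S \<subseteq> V\<close> factorises; at most \<open>2\<^bsup>r|S|\<^esup>\<close> lists have union \<open>S\<close>.\<close>

lemma sum_power_card_lists_le:
  assumes V: "finite V" and y: "0 \<le> y" and \<theta>: "0 < \<theta>" "\<theta> \<le> 1" and s: "0 \<le> s"
  shows "(\<Sum>Ss | set Ss \<subseteq> Pow V \<and> length Ss = r \<and> real (card (\<Union>(set Ss))) \<le> s. y ^ card (\<Union>(set Ss)))
    \<le> exp (s * ln (1 / \<theta>) + \<theta> * 2 ^ r * y * real (card V))"
proof -
  let ?\<L> = "{Ss. set Ss \<subseteq> Pow V \<and> length Ss = r \<and> real (card (\<Union>(set Ss))) \<le> s}"
  have fin: "finite {Ss. set Ss \<subseteq> Pow V \<and> length Ss = r}" using V by (intro finite_lists_length_eq) auto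
  have fin': "finite ?\<L>" by (rule finite_subset[OF _ fin]) auto
  have "(\<Sum>Ss\<in>?\<L>. y ^ card (\<Union>(set Ss))) =
      (\<Sum>S\<in>Pow V. \<Sum>Ss\<in>{Ss \<in> ?\<L>. \<Union>(set Ss) = S}. y ^ card (\<Union>(set Ss)))"
    by (rule sum.group[symmetric]) (use fin' V in auto)
  also have "\<dots> \<le> (\<Sum>S\<in>Pow V. exp (s * ln (1 / \<theta>)) * (\<theta> * 2 ^ r * y) ^ card S)"
  proof (rule sum_mono)
    fix S assume S: "S \<in> Pow V"
    then have finS: "finite S" using V finite_subset by auto
    show "(\<Sum>Ss\<in>{Ss \<in> ?\<L>. \<Union>(set Ss) = S}. y ^ card (\<Union>(set Ss))) \<le>
        exp (s * ln (1 / \<theta>)) * (\<theta> * 2 ^ r * y) ^ card S"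
    proof (cases "real (card S) \<le> s")
      case True
      have "(\<Sum>Ss\<in>{Ss \<in> ?\<L>. \<Union>(set Ss) = S}. y ^ card (\<Union>(set Ss))) =
          real (card {Ss \<in> ?\<L>. \<Union>(set Ss) = S}) * y ^ card S" by simp
      also have "\<dots> \<le> (2 ^ r) ^ card S * y ^ card S"
      proof (rule mult_right_mono)
        have "card {Ss \<in> ?\<L>. \<Union>(set Ss) = S} \<le> card {Ss. set Ss \<subseteq> Pow S \<and> length Ss = r}"
          using finS by (intro card_mono finite_lists_length_eq) auto
        also have "\<dots> = (2 ^ r) ^ card S"
          using finS by (simp add: card_lists_length_eq card_Pow power_mult[symmetric] mult.commute)
        finally have "real (card {Ss \<in> ?\<L>. \<Union>(set Ss) = S}) \<le> real ((2 ^ r) ^ card S)"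
          by (simp only: of_nat_le_iff)
        then show "real (card {Ss \<in> ?\<L>. \<Union>(set Ss) = S}) \<le> (2 ^ r) ^ card S" by simp
      qed (use y in simp)
      also have "\<dots> = 1 * ((2 ^ r) ^ card S * y ^ card S)" by simp
      also have "\<dots> \<le> (exp (s * ln (1 / \<theta>)) * \<theta> ^ card S) * ((2 ^ r) ^ card S * y ^ card S)"
      proof (rule mult_right_mono)
        have "ln \<theta> \<le> 0" using \<theta> by simp
        then have "0 \<le> (real (card S) - s) * ln \<theta>" using True by (simp add: mult_nonpos_nonpos)
        then have "1 \<le> exp (s * ln (1 / \<theta>) + ln \<theta> * real (card S))"
          using \<theta> by (simp add: ln_div algebra_simps)
        then show "1 \<le> exp (s * ln (1 / \<theta>)) * \<theta> ^ card S"
          using \<theta> by (simp add: exp_add exp_of_nat2_mult)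
      qed (use y in simp)
      finally show ?thesis by (simp add: power_mult_distrib mult_ac)
    next
      case False
      then have "{Ss \<in> ?\<L>. \<Union>(set Ss) = S} = {}" by auto
      then show ?thesis using y \<theta> by (simp only: sum.empty) simp
    qed
  qed
  also have "\<dots> = exp (s * ln (1 / \<theta>)) * (\<Sum>S\<in>Pow V. (\<theta> * 2 ^ r * y) ^ card S)"
    by (simp add: sum_distrib_left)
  also have "(\<Sum>S\<in>Pow V. (\<theta> * 2 ^ r * y) ^ card S) = (1 + \<theta> * 2 ^ r * y) ^ card V"
    using prod_add[OF V, of "\<lambda>_. \<theta> * 2 ^ r * y" "\<lambda>_. 1"] by (simp add: add.commute)
  also have "exp (s * ln (1 / \<theta>)) * (1 + \<theta> * 2 ^ r * y) ^ card V \<le>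
      exp (s * ln (1 / \<theta>)) * exp (\<theta> * 2 ^ r * y) ^ card V"
    by (intro mult_left_mono power_mono) (use y \<theta> in \<open>auto simp: exp_ge_add_one_self\<close>)
  also have "\<dots> = exp (s * ln (1 / \<theta>) + \<theta> * 2 ^ r * y * real (card V))"
    by (simp add: exp_add exp_of_nat2_mult)
  finally show ?thesis .
qed

text \<open>For \<open>l \<le> 1\<close> the exponent, in units of \<open>q * card V\<close>, is at
  most \<open>(l + l ^ 2) * x - l * (x + y) = l ^ 2 * x - l * y\<close>. A bound
  \<open>x\<^sub>0\<close> common to all containers allows a single \<open>l\<close> to make this at
  most \<open>- l * y / 2\<close>.\<close>

lemma prob_random_subset_tail_le:
  fixes x x\<^sub>0 y l q :: real
  assumes V: "finite V" and q: "0 \<le> q" "q \<le> 1" and S: "S \<subseteq> V" and X: "X \<subseteq> V"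
    and l: "0 \<le> l" "l \<le> 1" "l * x\<^sub>0 \<le> y / 2"
    and x: "real (card X) \<le> x * real (card V)" "x \<le> x\<^sub>0"
  shows "measure_pmf.prob (random_subset V q)
      {R. S \<subseteq> R \<and> (x + y) * q * real (card V) \<le> real (card (R \<inter> X))}
    \<le> (3 * q) ^ card S * exp (- (l * y / 2) * q * real (card V))"
proof -
  let ?N = "real (card V)"
  have el: "exp l \<le> 3" using l exp_le by (meson exp_le_cancel_iff order_trans)
  have el2: "exp l - 1 \<le> l + l\<^sup>2" using exp_bound[of l] l by simp
  have "l * l * x \<le> l * (y / 2)"
    using l x(2) mult_left_mono[OF mult_left_mono[OF x(2) l(1)] l(1)] mult_left_mono[OF l(3) l(1)]
    by (simp add: mult.assoc)
  then have "(l + l\<^sup>2) * x - l * (x + y) \<le> - (l * y / 2)"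
    by (simp add: power2_eq_square algebra_simps)
  then have *: "((l + l\<^sup>2) * x - l * (x + y)) * (q * ?N) \<le> - (l * y / 2) * (q * ?N)"
    using q by (intro mult_right_mono) auto
  have "q * (exp l - 1) * real (card X) \<le> q * (l + l\<^sup>2) * (x * ?N)"
    using el2 q x(1) l by (intro mult_mono mult_left_mono) auto
  then have **: "- l * ((x + y) * q * ?N) + q * (exp l - 1) * real (card X) \<le> - (l * y / 2) * q * ?N"
    using * by (simp add: algebra_simps)
  have "measure_pmf.prob (random_subset V q)
      {R. S \<subseteq> R \<and> (x + y) * q * ?N \<le> real (card (R \<inter> X))}
    \<le> exp (- l * ((x + y) * q * ?N)) * ((q * exp l) ^ card S * exp (q * (exp l - 1) * real (card X)))"
    by (rule prob_random_subset_tail[OF V q S X l(1)])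
  also have "\<dots> = (q * exp l) ^ card S * exp (- l * ((x + y) * q * ?N) + q * (exp l - 1) * real (card X))"
    by (simp only: exp_add mult_ac)
  also have "\<dots> \<le> (3 * q) ^ card S * exp (- (l * y / 2) * q * ?N)"
  proof (rule mult_mono)
    show "(q * exp l) ^ card S \<le> (3 * q) ^ card S"
      using q mult_left_mono[OF el q(1)] by (intro power_mono) (auto simp: mult.commute)
  qed (use ** q in auto)
  finally show ?thesis .
qed

text \<open>After the union bound the index set is enlarged to all lists with small union, whose
  weighted number does not depend on the containers; the factor \<open>q\<close> per fingerprint
  vertex keeps it small.\<close>

lemma prob_union_containers_le:
  fixes x :: "'a set list \<Rightarrow> real"
  assumes V: "finite V" and q: "0 \<le> q" "q \<le> 1"
    and l: "0 \<le> l" "l \<le> 1" "l * x\<^sub>0 \<le> y / 2"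
    and \<theta>: "0 < \<theta>" "\<theta> \<le> 1" and s: "0 \<le> s"
    and J: "J \<subseteq> {Ss. set Ss \<subseteq> Pow V \<and> length Ss = r \<and> real (card (\<Union>(set Ss))) \<le> s}"
    and X: "\<And>Ss. Ss \<in> J \<Longrightarrow> X Ss \<subseteq> V \<and> real (card (X Ss)) \<le> x Ss * real (card V) \<and> x Ss \<le> x\<^sub>0"
  shows "measure_pmf.prob (random_subset V q)
      (\<Union>Ss\<in>J. {R. \<Union>(set Ss) \<subseteq> R \<and> (x Ss + y) * q * real (card V) \<le> real (card (R \<inter> X Ss))})
    \<le> exp (s * ln (1 / \<theta>) + \<theta> * 2 ^ r * (3 * q) * real (card V) - (l * y / 2) * q * real (card V))"
    (is "measure_pmf.prob ?M (\<Union>Ss\<in>J. ?Ev Ss) \<le> _")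
proof -
  let ?\<L> = "{Ss. set Ss \<subseteq> Pow V \<and> length Ss = r \<and> real (card (\<Union>(set Ss))) \<le> s}"
  have fin: "finite ?\<L>"
    by (rule finite_subset[of _ "{Ss. set Ss \<subseteq> Pow V \<and> length Ss = r}"])
       (use V in \<open>auto intro: finite_lists_length_eq\<close>)
  then have finJ: "finite J" using J finite_subset by blast
  have "measure_pmf.prob ?M (\<Union>Ss\<in>J. ?Ev Ss) \<le> (\<Sum>Ss\<in>J. measure_pmf.prob ?M (?Ev Ss))"
    by (rule measure_pmf.finite_measure_subadditive_finite) (use finJ in auto)
  also have "\<dots> \<le> (\<Sum>Ss\<in>J. (3 * q) ^ card (\<Union>(set Ss)) * exp (- (l * y / 2) * q * real (card V)))"
  proof (rule sum_mono)
    fix Ss assume Ss: "Ss \<in> J"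
    then have "\<Union>(set Ss) \<subseteq> V" using J by auto
    then show "measure_pmf.prob ?M (?Ev Ss) \<le>
        (3 * q) ^ card (\<Union>(set Ss)) * exp (- (l * y / 2) * q * real (card V))"
      using X[OF Ss] by (intro prob_random_subset_tail_le[OF V q _ _ l]) auto
  qed
  also have "\<dots> \<le> (\<Sum>Ss\<in>?\<L>. (3 * q) ^ card (\<Union>(set Ss)) * exp (- (l * y / 2) * q * real (card V)))"
    by (rule sum_mono2[OF fin J]) (use q in auto)
  also have "\<dots> = (\<Sum>Ss\<in>?\<L>. (3 * q) ^ card (\<Union>(set Ss))) * exp (- (l * y / 2) * q * real (card V))"
    by (rule sum_distrib_right[symmetric])
  also have "\<dots> \<le> exp (s * ln (1 / \<theta>) + \<theta> * 2 ^ r * (3 * q) * real (card V)) *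
      exp (- (l * y / 2) * q * real (card V))"
    by (rule mult_right_mono[OF sum_power_card_lists_le[OF V _ \<theta> s]]) (use q in auto)
  also have "\<dots> = exp (s * ln (1 / \<theta>) + \<theta> * 2 ^ r * (3 * q) * real (card V) - (l * y / 2) * q * real (card V))"
    by (simp add: exp_add[symmetric])
  finally show ?thesis .
qed

section \<open>Transfer of stability to the random set\<close>

lemma card_Union_list_le:
  fixes s :: real
  assumes "\<And>S. S \<in> set Ss \<Longrightarrow> real (card S) \<le> s"
  shows "real (card (\<Union>(set Ss))) \<le> real (length Ss) * s"
  using assms
proof (induction Ss)
  case (Cons S Ss)
  have "real (card (\<Union>(set (S # Ss)))) \<le> real (card S) + real (card (\<Union>(set Ss)))"
    using card_Un_le[of S "\<Union>(set Ss)"] by (simp del: of_nat_add add: of_nat_add[symmetric])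
  also have "\<dots> \<le> s + real (length Ss) * s" using Cons by (intro add_mono) auto
  finally show ?case by (simp add: algebra_simps)
qed simp

text \<open>Turns \<open>p ^ k * |H| \<ge> 2\<close> into \<open>p * |V| > 1\<close>, the condition
  that permits rounding up fingerprint sizes.\<close>

lemma card_edges_le_power:
  assumes "uniform_hypergraph k H"
  shows "card (edges H) \<le> card (verts H) ^ k"
proof -
  have fin: "finite (verts H)" using assms by (simp add: uniform_hypergraph_def)
  have "finite {e. e \<subseteq> verts H \<and> card e = k}"
    by (rule finite_subset[of _ "Pow (verts H)"]) (use fin in auto)
  then have "card (edges H) \<le> card {e. e \<subseteq> verts H \<and> card e = k}"
    by (rule card_mono) (use assms in \<open>auto simp: uniform_hypergraph_def\<close>)
  also have "\<dots> = card (verts H) choose k"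
    by (rule n_subsets[OF fin])
  also have "\<dots> \<le> card (verts H) ^ k"
    by (cases "k \<le> card (verts H)") (simp_all add: binomial_le_pow binomial_eq_0)
  finally show ?thesis .
qed

text \<open>A container smaller than \<open>(\<alpha> - \<epsilon>) * |V|\<close> serves as
  \<open>X\<close> itself; otherwise stability supplies one \<open>B\<close> and
  \<open>X = A - B\<close>. In both cases \<open>X\<close> is fixed before \<open>W\<close>. Since
  \<open>W\<close> loses at most \<open>y / 2 * q * |V|\<close> outside \<open>A\<close>, it exceeds
  the share \<open>x * q * |V|\<close> of \<open>X\<close> by the margin
  \<open>y * q * |V|\<close>.\<close>

lemma stable_container:
  fixes H :: "'a hypergraph"
  assumes V: "finite (verts H)" and q: "0 \<le> q"
    and stable: "real (card A) \<ge> (\<alpha> - \<epsilon>) * real (card (verts H)) \<Longrightarrow>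
      real (card (edges (induced H A))) \<ge> \<epsilon> * real (card (edges H)) \<or>
      (\<exists>B\<in>\<B>. real (card (A - B)) \<le> \<delta> / 2 * real (card (verts H)))"
    and A: "A \<subseteq> verts H" "real (card (edges (induced H A))) < \<epsilon> * real (card (edges H))"
    and y: "2 * y \<le> \<epsilon>" "4 * y \<le> \<delta>" "\<delta> > 0" "\<epsilon> > 0" "\<alpha> > 0" and \<xi>: "\<xi> \<le> y / 2"
    and t: "t \<le> y / 2 * q * real (card (verts H))"
  shows "\<exists>X x. X \<subseteq> verts H \<and> real (card X) \<le> x * real (card (verts H)) \<and> x \<le> \<alpha> + \<delta> \<and>
    (\<forall>W\<subseteq>verts H. (\<alpha> - \<xi>) * q * real (card (verts H)) \<le> real (card W) \<longrightarrow>
      (\<forall>B\<in>\<B>. \<delta> * q * real (card (verts H)) \<le> real (card (W - B))) \<longrightarrow>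
      real (card (W - A)) \<le> t \<longrightarrow> (x + y) * q * real (card (verts H)) \<le> real (card (W \<inter> X)))"
proof -
  let ?V = "verts H" let ?N = "real (card (verts H))"
  have cover: "real (card Y) \<le> real (card (W \<inter> X)) + real (card (W - A))"
    if "Y \<subseteq> (W \<inter> X) \<union> (W - A)" "W \<subseteq> ?V" for Y W X
  proof -
    have "card Y \<le> card ((W \<inter> X) \<union> (W - A))"
      using that finite_subset[OF that(2) V] by (intro card_mono) auto
    also have "\<dots> \<le> card (W \<inter> X) + card (W - A)" by (rule card_Un_le)
    finally show ?thesis by (simp del: of_nat_add add: of_nat_add[symmetric])
  qed
  have scale: "a * q * ?N \<le> b * q * ?N" if "a \<le> b" for a b
    using that q by (intro mult_right_mono) auto
  show ?thesis
  proof (cases "(\<alpha> - \<epsilon>) * ?N \<le> real (card A)")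
    case True
    from stable[OF True] A(2) obtain B where B: "B \<in> \<B>" "real (card (A - B)) \<le> \<delta> / 2 * ?N"
      by (auto simp: not_le[symmetric])
    have "(\<delta> / 2 + y) * q * ?N \<le> real (card (W \<inter> (A - B)))"
      if W: "W \<subseteq> ?V" "\<delta> * q * ?N \<le> real (card (W - B))" "real (card (W - A)) \<le> t" for W
    proof -
      have "real (card (W - B)) \<le> real (card (W \<inter> (A - B))) + real (card (W - A))"
        by (rule cover) (use W in auto)
      then have "\<delta> * q * ?N - y / 2 * q * ?N \<le> real (card (W \<inter> (A - B)))" using W t by linarith
      moreover have "(\<delta> / 2 + y) * q * ?N \<le> (\<delta> - y / 2) * q * ?N" by (rule scale) (use y in linarith)
      ultimately show ?thesis by (simp add: left_diff_distrib)
    qed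
    then show ?thesis using A(1) B y by (intro exI[of _ "A - B"] exI[of _ "\<delta> / 2"]) auto
  next
    case False
    have "(\<alpha> - \<epsilon> + y) * q * ?N \<le> real (card (W \<inter> A))"
      if W: "W \<subseteq> ?V" "(\<alpha> - \<xi>) * q * ?N \<le> real (card W)" "real (card (W - A)) \<le> t" for W
    proof -
      have "real (card W) \<le> real (card (W \<inter> A)) + real (card (W - A))"
        by (rule cover) (use W in auto)
      then have "(\<alpha> - \<xi>) * q * ?N - y / 2 * q * ?N \<le> real (card (W \<inter> A))" using W t by linarith
      moreover have "(\<alpha> - \<epsilon> + y) * q * ?N \<le> (\<alpha> - \<xi> - y / 2) * q * ?N"
        by (rule scale) (use y \<xi> in linarith)
      ultimately show ?thesis by (simp add: left_diff_distrib)
    qed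
    then show ?thesis using A(1) False y by (intro exI[of _ A] exI[of _ "\<alpha> - \<epsilon>"]) auto
  qed
qed

lemma exists_sparsity_scale:
  fixes a b u v :: real
  assumes "0 \<le> a" "0 \<le> b" "0 < u" "0 < v"
  shows "\<exists>\<eta>>0. \<eta> \<le> 1 \<and> \<eta> * a \<le> u \<and> \<eta> * b \<le> v"
proof (intro exI conjI)
  let ?\<eta> = "min 1 (min (u / (a + 1)) (v / (b + 1)))"
  show "0 < ?\<eta>" using assms by simp
  show "?\<eta> \<le> 1" by simp
  have "?\<eta> * a \<le> u / (a + 1) * (a + 1)" using assms by (intro mult_mono) auto
  then show "?\<eta> * a \<le> u" using assms by simp
  have "?\<eta> * b \<le> v / (b + 1) * (b + 1)" using assms by (intro mult_mono) auto
  then show "?\<eta> * b \<le> v" using assms by simp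
qed

text \<open>The tail exponent \<open>l * y / 2\<close> is divided up: an eighth of
  \<open>l * y\<close> pays for \<open>s * ln (1 / \<theta>)\<close>, another eighth for the sum
  over fingerprints, and a quarter remains. Hence \<open>\<theta>\<close> is fixed before
  \<open>\<eta>\<close>.\<close>

lemma stable_transference:
  fixes H :: "'a hypergraph" and Cn :: "'a set list \<Rightarrow> 'a set"
  assumes V: "finite (verts H)" and q: "0 < q" "q \<le> 1"
    and \<eta>: "0 < \<eta>" "\<eta> * (2 * real r * ln (1 / \<theta>)) \<le> l * y / 8" "\<eta> * (2 * real m) \<le> y / 2"
    and \<theta>: "0 < \<theta>" "\<theta> \<le> 1" "\<theta> * 2 ^ r * 3 \<le> l * y / 8"
    and l: "0 \<le> l" "l \<le> 1" "l * (\<alpha> + \<delta>) \<le> y / 2"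
    and y: "2 * y \<le> \<epsilon>" "4 * y \<le> \<delta>" "\<delta> > 0" "\<epsilon> > 0" "\<alpha> > 0" and \<xi>: "\<xi> \<le> y / 2"
    and pos: "0 < \<xi> * q ^ k * real (card (edges H))"
    and stable: "\<And>A. A \<subseteq> verts H \<Longrightarrow> real (card A) \<ge> (\<alpha> - \<epsilon>) * real (card (verts H)) \<Longrightarrow>
      real (card (edges (induced H A))) \<ge> \<epsilon> * real (card (edges H)) \<or>
      (\<exists>B\<in>\<B>. real (card (A - B)) \<le> \<delta> / 2 * real (card (verts H)))"
    and Cn: "\<And>W. W \<subseteq> verts H \<Longrightarrow>
      real (card (edges (induced H W))) < \<xi> * q ^ k * real (card (edges H)) \<Longrightarrow>
      \<exists>Ss. length Ss = r \<and>
        (\<forall>S\<in>set Ss. S \<subseteq> W \<and> real (card S) \<le> 2 * (\<eta> * q) * real (card (verts H))) \<and>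
        Cn Ss \<subseteq> verts H \<and>
        real (card (W - Cn Ss)) \<le> real m * (2 * (\<eta> * q) * real (card (verts H))) \<and>
        real (card (edges (induced H (Cn Ss)))) < \<epsilon> * real (card (edges H))"
  shows "measure_pmf.prob (random_subset (verts H) q)
      {R. \<forall>W\<subseteq>R. real (card W) \<ge> (\<alpha> - \<xi>) * q * real (card (verts H)) \<longrightarrow>
        (\<forall>B\<in>\<B>. real (card (W - B)) \<ge> \<delta> * q * real (card (verts H))) \<longrightarrow>
        real (card (edges (induced H W))) \<ge> \<xi> * q ^ k * real (card (edges H)) \<and>
        \<xi> * q ^ k * real (card (edges H)) > 0}
    \<ge> 1 - exp (- (l * y / 4) * q * real (card (verts H)))"
    (is "measure_pmf.prob ?M ?Good \<ge> _")
proof -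
  let ?V = "verts H" let ?N = "real (card (verts H))"
  define s where "s = real r * (2 * (\<eta> * q) * ?N)"
  define t where "t = real m * (2 * (\<eta> * q) * ?N)"
  have s: "0 \<le> s" using \<eta> q by (simp add: s_def)
  have t: "t \<le> y / 2 * q * ?N"
    using mult_right_mono[OF \<eta>(3), of "q * ?N"] q by (simp add: t_def mult_ac)
  \<comment> \<open>Neither \<open>W\<close> nor the random set enters here, so the union bound has
    a fixed index set.\<close>
  define J where "J = {Ss. set Ss \<subseteq> Pow ?V \<and> length Ss = r \<and> real (card (\<Union>(set Ss))) \<le> s \<and>
    Cn Ss \<subseteq> ?V \<and> real (card (edges (induced H (Cn Ss)))) < \<epsilon> * real (card (edges H))}"
  define trap where "trap Ss X x \<longleftrightarrow> X \<subseteq> ?V \<and> real (card X) \<le> x * ?N \<and> x \<le> \<alpha> + \<delta> \<and>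
    (\<forall>W\<subseteq>?V. (\<alpha> - \<xi>) * q * ?N \<le> real (card W) \<longrightarrow>
      (\<forall>B\<in>\<B>. \<delta> * q * ?N \<le> real (card (W - B))) \<longrightarrow>
      real (card (W - Cn Ss)) \<le> t \<longrightarrow> (x + y) * q * ?N \<le> real (card (W \<inter> X)))" for Ss X x
  have "\<forall>Ss\<in>J. \<exists>X x. trap Ss X x"
  proof
    fix Ss assume Ss: "Ss \<in> J"
    then have A: "Cn Ss \<subseteq> ?V" "real (card (edges (induced H (Cn Ss)))) < \<epsilon> * real (card (edges H))"
      by (auto simp: J_def)
    show "\<exists>X x. trap Ss X x"
      unfolding trap_def
      by (rule stable_container[OF V _ stable[OF A(1)] A y \<xi> t]) (use q in auto)
  qed
  then obtain X x where trap: "\<And>Ss. Ss \<in> J \<Longrightarrow> trap Ss (X Ss) (x Ss)" by metis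
  let ?Ev = "\<lambda>Ss. {R. \<Union>(set Ss) \<subseteq> R \<and> (x Ss + y) * q * ?N \<le> real (card (R \<inter> X Ss))}"
  \<comment> \<open>An exceptional \<open>W \<subseteq> R\<close> has its fingerprint and its dense
    trace on \<open>X Ss\<close> inside \<open>R\<close>. The intersection with the support provides
    \<open>R \<subseteq> verts H\<close>.\<close>
  have bad: "- ?Good \<inter> set_pmf ?M \<subseteq> (\<Union>Ss\<in>J. ?Ev Ss)"
  proof
    fix R assume R: "R \<in> - ?Good \<inter> set_pmf ?M"
    then have RV: "R \<subseteq> ?V" using set_pmf_random_subset[of ?V q] by auto
    obtain W where W: "W \<subseteq> R" "(\<alpha> - \<xi>) * q * ?N \<le> real (card W)"
      "\<forall>B\<in>\<B>. \<delta> * q * ?N \<le> real (card (W - B))"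
      "real (card (edges (induced H W))) < \<xi> * q ^ k * real (card (edges H))"
      using R pos by (auto simp: not_le)
    have WV: "W \<subseteq> ?V" using W(1) RV by auto
    from Cn[OF WV W(4)] obtain Ss where Ss: "length Ss = r"
      "\<forall>S\<in>set Ss. S \<subseteq> W \<and> real (card S) \<le> 2 * (\<eta> * q) * ?N" "Cn Ss \<subseteq> ?V"
      "real (card (W - Cn Ss)) \<le> t" "real (card (edges (induced H (Cn Ss)))) < \<epsilon> * real (card (edges H))"
      unfolding t_def by blast
    have "real (card (\<Union>(set Ss))) \<le> s"
      using card_Union_list_le[of Ss "2 * (\<eta> * q) * ?N"] Ss(1,2) by (simp add: s_def)
    then have SsJ: "Ss \<in> J" using Ss WV by (auto simp: J_def)
    have "(x Ss + y) * q * ?N \<le> real (card (W \<inter> X Ss))"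
      using trap[OF SsJ] W WV Ss(4) unfolding trap_def by blast
    also have "\<dots> \<le> real (card (R \<inter> X Ss))"
      using W(1) finite_subset[OF RV V] by (intro of_nat_mono card_mono) auto
    finally have "R \<in> ?Ev Ss" using Ss(2) W(1) by auto
    then show "R \<in> (\<Union>Ss\<in>J. ?Ev Ss)" using SsJ by blast
  qed
  have "measure_pmf.prob ?M (- ?Good) = measure_pmf.prob ?M (- ?Good \<inter> set_pmf ?M)"
    by (rule measure_Int_set_pmf[symmetric])
  also have "\<dots> \<le> measure_pmf.prob ?M (\<Union>Ss\<in>J. ?Ev Ss)"
    by (rule measure_pmf.finite_measure_mono[OF bad]) simp
  also have "\<dots> \<le> exp (s * ln (1 / \<theta>) + \<theta> * 2 ^ r * (3 * q) * ?N - (l * y / 2) * q * ?N)"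
    by (rule prob_union_containers_le[OF V _ q(2) l \<theta>(1,2) s])
       (use q trap in \<open>auto simp: J_def trap_def\<close>)
  also have "\<dots> \<le> exp (- (l * y / 4) * q * ?N)"
  proof -
    have "s * ln (1 / \<theta>) \<le> l * y / 8 * q * ?N"
      using mult_right_mono[OF \<eta>(2), of "q * ?N"] q by (simp add: s_def mult_ac)
    moreover have "\<theta> * 2 ^ r * (3 * q) * ?N \<le> l * y / 8 * q * ?N"
      using mult_right_mono[OF \<theta>(3), of "q * ?N"] q by (simp add: mult_ac)
    moreover have "l * y / 8 * q * ?N + l * y / 8 * q * ?N - (l * y / 2) * q * ?N = - (l * y / 4) * q * ?N"
      by (simp add: algebra_simps)
    ultimately show ?thesis by simp
  qed
  finally have "measure_pmf.prob ?M (- ?Good) \<le> exp (- (l * y / 4) * q * ?N)" .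
  moreover have "measure_pmf.prob ?M (- ?Good) = 1 - measure_pmf.prob ?M ?Good"
    using measure_pmf.prob_compl[of ?Good ?M] by (simp add: Compl_eq_Diff_UNIV)
  ultimately show ?thesis by linarith
qed

text \<open>Pruning only lowers weights, so a \<open>W\<close> sparse in \<open>H\<close> is sparse
  for \<open>G\<close>. Conversely, a container of weight below half of the
  \<open>\<epsilon>\<close> budget stays within it when the pruned edges return, as these cost at
  most the other half.\<close>

lemma sparse_induced_container:
  fixes H :: "'a hypergraph"
  assumes H: "uniform_hypergraph k H"
    and mu: "\<And>i. i < k \<Longrightarrow>
      mu i H p \<le> K * p ^ (2 * i) * (real (card (edges H)))\<^sup>2 / real (card (verts H))"
    and p: "0 < p" "p \<le> 1" and pN: "1 \<le> p * real (card (verts H))"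
    and \<epsilon>: "\<epsilon> > 0" and M: "M > 0" "real k * 2 ^ k * K / M \<le> \<epsilon> / 2"
    and E_pos: "card (edges H) > 0"
    and containers: "\<And>V p D (G :: 'a set \<Rightarrow> real).
      uniform_weights k V G \<Longrightarrow> degrees_le M V p D G \<Longrightarrow> 1 \<le> p * real (card V) \<Longrightarrow> p > 0 \<Longrightarrow> D > 0 \<Longrightarrow>
      has_containers k r m \<xi> (\<epsilon> / 2) V p D G"
  shows "\<exists>Cn. \<forall>W\<subseteq>verts H.
    real (card (edges (induced H W))) \<le> \<xi> * p ^ k * real (card (edges H)) \<longrightarrow>
    (\<exists>Ss. length Ss = r \<and> (\<forall>S\<in>set Ss. S \<subseteq> W \<and> real (card S) \<le> 2 * p * real (card (verts H))) \<and>
      Cn Ss \<subseteq> verts H \<and> real (card (W - Cn Ss)) \<le> real m * (2 * p * real (card (verts H))) \<and>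
      real (card (edges (induced H (Cn Ss)))) < \<epsilon> * real (card (edges H)))"
proof -
  let ?V = "verts H" let ?N = "real (card (verts H))" let ?m = "real (card (edges H))"
  define D where "D = ?m / ?N"
  have N: "card ?V > 0" using pN by (cases "card ?V = 0") auto
  have D_pos: "D > 0" using E_pos N by (simp add: D_def)
  have DN: "D * ?N = ?m" using N by (simp add: D_def)
  obtain G where G: "uniform_weights k ?V G" "degrees_le M ?V p D G"
    and wt_le: "\<And>W. W \<subseteq> ?V \<Longrightarrow> wt G {} W \<le> real (card {e \<in> edges H. e \<subseteq> W})"
    and le_wt: "\<And>W. W \<subseteq> ?V \<Longrightarrow>
      real (card {e \<in> edges H. e \<subseteq> W}) \<le> wt G {} W + real k * 2 ^ k * K / M * ?m"
    using prune_heavy_edges[OF H mu p M(1) E_pos N D_def] by blast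
  obtain Cn where Cn: "\<And>W. W \<subseteq> ?V \<Longrightarrow> wt G {} W \<le> \<xi> * p ^ k * D * ?N \<Longrightarrow>
      (\<exists>Ss. length Ss = r \<and> (\<forall>S\<in>set Ss. S \<subseteq> W \<and> real (card S) \<le> 2 * p * ?N) \<and>
         Cn Ss \<subseteq> ?V \<and> real (card (W - Cn Ss)) \<le> real m * (2 * p * ?N) \<and>
         wt G {} (Cn Ss) < \<epsilon> / 2 * D * ?N)"
    using containers[OF G pN p(1) D_pos] unfolding has_containers_def by blast
  show ?thesis
  proof (rule exI[of _ Cn], intro allI impI)
    fix W assume W: "W \<subseteq> ?V" "real (card (edges (induced H W))) \<le> \<xi> * p ^ k * ?m"
    have "wt G {} W \<le> \<xi> * p ^ k * D * ?N"
      using wt_le[OF W(1)] W(2) DN by (simp add: induced_def mult.assoc)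
    from Cn[OF W(1) this] obtain Ss where Ss: "length Ss = r"
      "\<forall>S\<in>set Ss. S \<subseteq> W \<and> real (card S) \<le> 2 * p * ?N" "Cn Ss \<subseteq> ?V"
      "real (card (W - Cn Ss)) \<le> real m * (2 * p * ?N)" "wt G {} (Cn Ss) < \<epsilon> / 2 * D * ?N"
      by blast
    have "real k * 2 ^ k * K / M * ?m \<le> \<epsilon> / 2 * ?m" using M(2) by (rule mult_right_mono) simp
    moreover have "wt G {} (Cn Ss) < \<epsilon> / 2 * ?m" using Ss(5) DN by (simp add: mult.assoc)
    moreover have "real (card (edges (induced H (Cn Ss)))) \<le> wt G {} (Cn Ss) + real k * 2 ^ k * K / M * ?m"
      using le_wt[OF Ss(3)] by (simp add: induced_def)
    ultimately have "real (card (edges (induced H (Cn Ss)))) < \<epsilon> * ?m" by linarith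
    then show "\<exists>Ss. length Ss = r \<and> (\<forall>S\<in>set Ss. S \<subseteq> W \<and> real (card S) \<le> 2 * p * ?N) \<and>
      Cn Ss \<subseteq> ?V \<and> real (card (W - Cn Ss)) \<le> real m * (2 * p * ?N) \<and>
      real (card (edges (induced H (Cn Ss)))) < \<epsilon> * ?m"
      using Ss by blast
  qed
qed

theorem theorem3p4:
  fixes H :: "nat \<Rightarrow> 'a hypergraph"
    and k :: nat
    and \<alpha> K :: real
    and \<B> :: "nat \<Rightarrow> 'a set set"
    and p :: "nat \<Rightarrow> real"
  assumes uniform: "\<And>n. uniform_hypergraph k (H n)"
    and \<alpha>_pos: "\<alpha> > 0"
    and \<B>_subset: "\<And>n. \<B> n \<subseteq> Pow (verts (H n))"
    and stable: "stable_seq \<alpha> \<B> H"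
    and K_pos: "K > 0"
    and p_prob: "\<And>n. 0 \<le> p n \<and> p n \<le> 1"
    and p_lim: "filterlim (\<lambda>n. p n ^ k * real (card (edges (H n)))) at_top sequentially"
    and bounded: "bounded_seq k K p H"
    and \<B>_card: "\<exists>g \<in> o(\<lambda>n. p n * real (card (verts (H n)))).
                    eventually (\<lambda>n. real (card (\<B> n)) = exp (g n)) sequentially"
  shows "\<forall>\<delta>>0. \<exists>\<xi>>0. \<exists>b>0. \<exists>C>0. \<exists>N>0. \<forall>n\<ge>N. \<forall>q::real. C * p n \<le> q \<and> q \<le> 1 \<longrightarrow>
           measure_pmf.prob (random_subset (verts (H n)) q)
             {R. \<forall>W\<subseteq>R.
                   real (card W) \<ge> (\<alpha> - \<xi>) * q * real (card (verts (H n))) \<longrightarrow>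
                   (\<forall>B\<in>\<B> n. real (card (W - B)) \<ge> \<delta> * q * real (card (verts (H n)))) \<longrightarrow>
                   real (card (edges (induced (H n) W)))
                     \<ge> \<xi> * q ^ k * real (card (edges (H n))) \<and>
                   \<xi> * q ^ k * real (card (edges (H n))) > 0}
           \<ge> 1 - exp (- b * q * real (card (verts (H n))))"
proof (intro allI impI)
  fix \<delta> :: real assume \<delta>: "\<delta> > 0"
  \<comment> \<open>Stability is used with half of the deviation demanded from \<open>W\<close>; the
    other half leaves room for the margin \<open>y\<close>.\<close>
  then have "\<delta> / 2 > 0" by simp
  with stable obtain \<epsilon> N\<^sub>1 where \<epsilon>: "\<epsilon> > 0" and stable\<^sub>1: "\<And>n A. n \<ge> N\<^sub>1 \<Longrightarrow> A \<subseteq> verts (H n) \<Longrightarrow>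
      real (card A) \<ge> (\<alpha> - \<epsilon>) * real (card (verts (H n))) \<Longrightarrow>
      real (card (edges (induced (H n) A))) \<ge> \<epsilon> * real (card (edges (H n))) \<or>
      (\<exists>B\<in>\<B> n. real (card (A - B)) \<le> \<delta> / 2 * real (card (verts (H n))))"
    unfolding stable_seq_def by meson
  \<comment> \<open>Chosen so that pruning costs at most half of \<open>\<epsilon>\<close>; the
    added 1 keeps \<open>M\<close> positive when \<open>k = 0\<close>.\<close>
  define M where "M = (real k * 2 ^ k * K + 1) / (\<epsilon> / 2)"
  have kK: "0 \<le> real k * 2 ^ k * K" using K_pos by simp
  have M: "M > 0" using kK \<epsilon> by (simp add: M_def)
  have "\<epsilon> / 2 * M = real k * 2 ^ k * K + 1" using \<epsilon> by (simp add: M_def)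
  then have M_le: "real k * 2 ^ k * K / M \<le> \<epsilon> / 2" using M by (simp add: pos_divide_le_eq)
  have "\<epsilon> / 2 > 0" using \<epsilon> by simp
  from sparse_set_containers[OF this M, of k, where 'a='a] obtain r m \<xi>\<^sub>0 where \<xi>\<^sub>0: "\<xi>\<^sub>0 > 0"
    and containers: "\<And>V p D (G :: 'a set \<Rightarrow> real).
      uniform_weights k V G \<Longrightarrow> degrees_le M V p D G \<Longrightarrow> 1 \<le> p * real (card V) \<Longrightarrow> p > 0 \<Longrightarrow> D > 0 \<Longrightarrow>
      has_containers k r m \<xi>\<^sub>0 (\<epsilon> / 2) V p D G"
    by blast
  define y where "y = min (\<epsilon> / 2) (\<delta> / 4)"
  have y: "0 < y" "2 * y \<le> \<epsilon>" "4 * y \<le> \<delta>" using \<epsilon> \<delta> by (auto simp: y_def)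
  define l where "l = min 1 (y / 2 / (\<alpha> + \<delta>))"
  have \<alpha>\<delta>: "\<alpha> + \<delta> > 0" using \<alpha>_pos \<delta> by simp
  have l: "0 < l" "l \<le> 1" using y \<alpha>\<delta> by (auto simp: l_def)
  have "l \<le> y / 2 / (\<alpha> + \<delta>)" unfolding l_def by (rule min.cobounded2)
  then have l_le: "l * (\<alpha> + \<delta>) \<le> y / 2" by (simp only: pos_le_divide_eq[OF \<alpha>\<delta>])
  have ly: "l * y / 8 > 0" using l y by simp
  define \<theta> where "\<theta> = min 1 (l * y / 8 / (2 ^ r * 3))"
  have \<theta>: "0 < \<theta>" "\<theta> \<le> 1" using ly by (auto simp: \<theta>_def)
  have "\<theta> \<le> l * y / 8 / (2 ^ r * 3)" unfolding \<theta>_def by (rule min.cobounded2)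
  moreover have "(0::real) < 2 ^ r * 3" by simp
  ultimately have \<theta>_le: "\<theta> * 2 ^ r * 3 \<le> l * y / 8" by (simp only: pos_le_divide_eq mult.assoc)
  have "0 \<le> 2 * real r * ln (1 / \<theta>)" using \<theta> by simp
  with exists_sparsity_scale[of "2 * real r * ln (1 / \<theta>)" "2 * real m" "l * y / 8" "y / 2"] ly y
  obtain \<eta> where \<eta>: "0 < \<eta>" "\<eta> \<le> 1" "\<eta> * (2 * real r * ln (1 / \<theta>)) \<le> l * y / 8"
    "\<eta> * (2 * real m) \<le> y / 2" by auto
  \<comment> \<open>The factor \<open>\<eta> ^ k\<close> converts sparsity at scale \<open>q\<close>
    into sparsity at the fingerprint scale \<open>\<eta> * q\<close>.\<close>
  define \<xi> where "\<xi> = min (y / 2) (\<xi>\<^sub>0 * \<eta> ^ k)"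
  have \<xi>: "0 < \<xi>" "\<xi> \<le> y / 2" "\<xi> \<le> \<xi>\<^sub>0 * \<eta> ^ k" using y \<xi>\<^sub>0 \<eta> by (auto simp: \<xi>_def)
  have "eventually (\<lambda>n. \<forall>i\<in>{..<k}. \<forall>q\<in>{0..1}. q \<ge> p n \<longrightarrow> mu i (H n) q
      \<le> K * q ^ (2 * i) * (real (card (edges (H n))))\<^sup>2 / real (card (verts (H n)))) sequentially"
    using bounded by (intro eventually_ball_finite) (auto simp: bounded_seq_def eventually_sequentially)
  moreover have "eventually (\<lambda>n. p n ^ k * real (card (edges (H n))) \<ge> 2) sequentially"
    using p_lim by (simp add: filterlim_at_top)
  ultimately have "eventually (\<lambda>n. (\<forall>i\<in>{..<k}. \<forall>q\<in>{0..1}. q \<ge> p n \<longrightarrow> mu i (H n) q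
      \<le> K * q ^ (2 * i) * (real (card (edges (H n))))\<^sup>2 / real (card (verts (H n)))) \<and>
      p n ^ k * real (card (edges (H n))) \<ge> 2) sequentially"
    by (rule eventually_conj)
  then obtain N\<^sub>2 where N\<^sub>2: "\<And>n. n \<ge> N\<^sub>2 \<Longrightarrow>
      (\<forall>i\<in>{..<k}. \<forall>q\<in>{0..1}. q \<ge> p n \<longrightarrow> mu i (H n) q
        \<le> K * q ^ (2 * i) * (real (card (edges (H n))))\<^sup>2 / real (card (verts (H n)))) \<and>
      p n ^ k * real (card (edges (H n))) \<ge> 2"
    unfolding eventually_sequentially by blast
  have main: "measure_pmf.prob (random_subset (verts (H n)) q)
      {R. \<forall>W\<subseteq>R. real (card W) \<ge> (\<alpha> - \<xi>) * q * real (card (verts (H n))) \<longrightarrow>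
        (\<forall>B\<in>\<B> n. real (card (W - B)) \<ge> \<delta> * q * real (card (verts (H n)))) \<longrightarrow>
        real (card (edges (induced (H n) W))) \<ge> \<xi> * q ^ k * real (card (edges (H n))) \<and>
        \<xi> * q ^ k * real (card (edges (H n))) > 0}
    \<ge> 1 - exp (- (l * y / 4) * q * real (card (verts (H n))))"
    if n: "n \<ge> max N\<^sub>1 N\<^sub>2" and q: "1 / \<eta> * p n \<le> q" "q \<le> 1" for n q
  proof -
    let ?N = "real (card (verts (H n)))"
    have p0: "0 \<le> p n" using p_prob by simp
    have big: "p n ^ k * real (card (edges (H n))) \<ge> 2" using N\<^sub>2 n by simp
    have "p n ^ k * real (card (edges (H n))) \<le> p n ^ k * ?N ^ k"
      using card_edges_le_power[OF uniform[of n]] p0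
      by (intro mult_left_mono) (auto simp flip: of_nat_power)
    then have "1 < (p n * ?N) ^ k" using big by (simp add: power_mult_distrib)
    then have pN: "1 < p n * ?N" using power_le_one[of "p n * ?N" k] p0 by (force simp: not_le[symmetric])
    have p_pos: "0 < p n" using pN p0 by (cases "p n = 0") auto
    have E_pos: "card (edges (H n)) > 0" using big by (cases "card (edges (H n)) = 0") auto
    have q_pos: "0 < q" using q(1) p_pos \<eta>(1) by (smt (verit) divide_pos_pos mult_pos_pos)
    have \<eta>q: "p n \<le> \<eta> * q" using q(1) \<eta>(1) by (simp add: field_simps)
    have \<eta>q1: "\<eta> * q \<le> 1" using \<eta> q(2) q_pos by (simp add: mult_le_one)
    have \<eta>q_pos: "0 < \<eta> * q" using \<eta> q_pos by simp
    have \<eta>qN: "1 \<le> \<eta> * q * ?N" using pN mult_right_mono[OF \<eta>q, of ?N] by simp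
    \<comment> \<open>The containers are built at \<open>\<eta> * q\<close>, not at
      \<open>p n\<close>. The moment bounds hold there because \<open>p n \<le> \<eta> * q\<close>,
      which is the reason for taking \<open>C\<close> to be \<open>1 / \<eta>\<close>.\<close>
    have "\<exists>Cn. \<forall>W\<subseteq>verts (H n).
      real (card (edges (induced (H n) W))) \<le> \<xi>\<^sub>0 * (\<eta> * q) ^ k * real (card (edges (H n))) \<longrightarrow>
      (\<exists>Ss. length Ss = r \<and> (\<forall>S\<in>set Ss. S \<subseteq> W \<and> real (card S) \<le> 2 * (\<eta> * q) * ?N) \<and>
        Cn Ss \<subseteq> verts (H n) \<and> real (card (W - Cn Ss)) \<le> real m * (2 * (\<eta> * q) * ?N) \<and>
        real (card (edges (induced (H n) (Cn Ss)))) < \<epsilon> * real (card (edges (H n))))"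
      by (rule sparse_induced_container[OF uniform _ \<eta>q_pos \<eta>q1 \<eta>qN \<epsilon> M M_le E_pos containers])
         (use N\<^sub>2[of n] n \<eta>q \<eta>q1 \<eta>q_pos in auto)
    then obtain Cn where Cn: "\<And>W. W \<subseteq> verts (H n) \<Longrightarrow>
      real (card (edges (induced (H n) W))) \<le> \<xi>\<^sub>0 * (\<eta> * q) ^ k * real (card (edges (H n))) \<Longrightarrow>
      (\<exists>Ss. length Ss = r \<and> (\<forall>S\<in>set Ss. S \<subseteq> W \<and> real (card S) \<le> 2 * (\<eta> * q) * ?N) \<and>
        Cn Ss \<subseteq> verts (H n) \<and> real (card (W - Cn Ss)) \<le> real m * (2 * (\<eta> * q) * ?N) \<and>
        real (card (edges (induced (H n) (Cn Ss)))) < \<epsilon> * real (card (edges (H n))))"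
      by blast
    have \<xi>q: "\<xi> * q ^ k * real (card (edges (H n))) \<le> \<xi>\<^sub>0 * (\<eta> * q) ^ k * real (card (edges (H n)))"
      using mult_right_mono[OF mult_right_mono[OF \<xi>(3), of "q ^ k"], of "real (card (edges (H n)))"] q_pos
      by (simp add: power_mult_distrib mult.assoc)
    show ?thesis
    proof (rule stable_transference[where Cn = Cn and r = r and m = m and \<eta> = \<eta> and \<theta> = \<theta>
          and \<epsilon> = \<epsilon>])
      show "finite (verts (H n))" using uniform[of n] by (simp add: uniform_hypergraph_def)
      show "0 < \<xi> * q ^ k * real (card (edges (H n)))" using \<xi>(1) q_pos E_pos by simp
      show "\<exists>Ss. length Ss = r \<and> (\<forall>S\<in>set Ss. S \<subseteq> W \<and> real (card S) \<le> 2 * (\<eta> * q) * ?N) \<and>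
        Cn Ss \<subseteq> verts (H n) \<and> real (card (W - Cn Ss)) \<le> real m * (2 * (\<eta> * q) * ?N) \<and>
        real (card (edges (induced (H n) (Cn Ss)))) < \<epsilon> * real (card (edges (H n)))"
        if "W \<subseteq> verts (H n)"
          "real (card (edges (induced (H n) W))) < \<xi> * q ^ k * real (card (edges (H n)))" for W
        by (rule Cn[OF that(1)]) (use that(2) \<xi>q in linarith)
    qed (use n q_pos q(2) \<eta> \<theta> \<theta>_le l l_le y \<delta> \<epsilon> \<alpha>_pos \<xi> stable\<^sub>1 in auto)
  qed
  have pos: "\<xi> > 0" "l * y / 4 > 0" "1 / \<eta> > 0" "max 1 (max N\<^sub>1 N\<^sub>2) > 0" using \<xi> l y \<eta> by auto
  show "\<exists>\<xi>>0. \<exists>b>0. \<exists>C>0. \<exists>N>0. \<forall>n\<ge>N. \<forall>q::real. C * p n \<le> q \<and> q \<le> 1 \<longrightarrow>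
           measure_pmf.prob (random_subset (verts (H n)) q)
             {R. \<forall>W\<subseteq>R.
                   real (card W) \<ge> (\<alpha> - \<xi>) * q * real (card (verts (H n))) \<longrightarrow>
                   (\<forall>B\<in>\<B> n. real (card (W - B)) \<ge> \<delta> * q * real (card (verts (H n)))) \<longrightarrow>
                   real (card (edges (induced (H n) W)))
                     \<ge> \<xi> * q ^ k * real (card (edges (H n))) \<and>
                   \<xi> * q ^ k * real (card (edges (H n))) > 0}
           \<ge> 1 - exp (- b * q * real (card (verts (H n))))"
    by (rule exI[of _ \<xi>], rule conjI[OF pos(1)], rule exI[of _ "l * y / 4"], rule conjI[OF pos(2)],
        rule exI[of _ "1 / \<eta>"], rule conjI[OF pos(3)],
        rule exI[of _ "max 1 (max N\<^sub>1 N\<^sub>2)"], rule conjI[OF pos(4)], intro allI impI, rule main) auto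
qed

end
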